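(* Let $G$ be a group belonging to the class $\mathcal{S}$, and suppose $G$ acts on the real line $\mathbb{R}$ by order-preserving homeomorphisms. Assume that there is an element $T\in G$ that acts on $\mathbb{R}$ without fixed points. Then there is a nonzero Radon measure $\mu$ on $\mathbb{R}$ which is quasi-preserved by $G$.
   Context: A group has subexponential growth if it is finitely generated and its word growth function (with respect to some, equivalently any, finite generating set) grows subexponentially. A group has locally subexponential growth if every finitely generated subgroup of it has subexponential growth (the group itself need not be finitely generated). The class $\mathcal{S}$ consists of the groups $G$ admitting a finite filtration $\{id\}=G^{d+1}\lhd G^{d}\lhd \cdots \lhd G^{1}\lhd G^{0}=G$ by subgroups that are normal in $G$, such that each successive quotient $G^{i-1}/G^{i}$ ($i=1,\dots,d+1$) has locally subexponential growth. (In particular all solvable groups and all groups of subexponential growth lie in $\mathcal{S}$.) A Borel measure $\mu$ on $\mathbb{R}$ is a Radon measure if it gives finite mass to compact sets. For $g$ acting on $\mathbb{R}$, $g_*\mu$ is the measure $B\mapsto \mu(g^{-1}(B))$. A measure $\mu$ is quasi-preserved (quasi-invariant) by $G$ if for every $g\in G$ there is $\lambda_g\in\mathbb{R}$ with $g_*\mu=\lambda_g\mu$. *)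

theory Defs
  imports "HOL-Analysis.Analysis" "HOL-Algebra.Algebra"
begin

definition word_ball :: "('a, 'b) monoid_scheme \<Rightarrow> 'a set \<Rightarrow> nat \<Rightarrow> 'a set" where
  "word_ball G S n =
     {foldr (\<otimes>\<^bsub>G\<^esub>) xs \<one>\<^bsub>G\<^esub> | xs. length xs \<le> n \<and> set xs \<subseteq> S \<union> m_inv G ` S}"

definition subexp_growth_wrt :: "('a, 'b) monoid_scheme \<Rightarrow> 'a set \<Rightarrow> bool" where
  "subexp_growth_wrt G S \<longleftrightarrow>
     (\<lambda>n. ln (real (card (word_ball G S n))) / real n) \<longlonglongrightarrow> 0"

definition has_subexp_growth :: "('a, 'b) monoid_scheme \<Rightarrow> bool" where
  "has_subexp_growth G \<longleftrightarrow>
     (\<exists>S. finite S \<and> S \<subseteq> carrier G \<and> generate G S = carrier G \<and> subexp_growth_wrt G S)"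

definition locally_subexp_growth :: "('a, 'b) monoid_scheme \<Rightarrow> bool" where
  "locally_subexp_growth G \<longleftrightarrow>
     (\<forall>S. finite S \<and> S \<subseteq> carrier G \<longrightarrow> has_subexp_growth (G\<lparr>carrier := generate G S\<rparr>))"

definition class_S :: "('a, 'b) monoid_scheme \<Rightarrow> bool" where
  "class_S G \<longleftrightarrow>
     (\<exists>(N :: nat \<Rightarrow> 'a set) d.
        N 0 = carrier G \<and> N (Suc d) = {\<one>\<^bsub>G\<^esub>} \<and>
        (\<forall>i \<le> Suc d. N i \<lhd> G) \<and>
        (\<forall>i \<le> d. N (Suc i) \<subseteq> N i) \<and>
        (\<forall>i \<le> d. locally_subexp_growth ((G\<lparr>carrier := N i\<rparr>) Mod N (Suc i))))"

definition order_pres_action :: "('a, 'b) monoid_scheme \<Rightarrow> ('a \<Rightarrow> real \<Rightarrow> real) \<Rightarrow> bool" where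
  "order_pres_action G \<phi> \<longleftrightarrow>
     \<phi> \<one>\<^bsub>G\<^esub> = id \<and>
     (\<forall>g\<in>carrier G. \<forall>h\<in>carrier G. \<phi> (g \<otimes>\<^bsub>G\<^esub> h) = \<phi> g \<circ> \<phi> h) \<and>
     (\<forall>g\<in>carrier G. strict_mono (\<phi> g) \<and> (\<exists>\<psi>. homeomorphism UNIV UNIV (\<phi> g) \<psi>))"

definition radon_measure :: "real measure \<Rightarrow> bool" where
  "radon_measure M \<longleftrightarrow> sets M = sets borel \<and> (\<forall>K. compact K \<longrightarrow> emeasure M K < \<infinity>)"

definition quasi_preserved :: "('a, 'b) monoid_scheme \<Rightarrow> ('a \<Rightarrow> real \<Rightarrow> real) \<Rightarrow> real measure \<Rightarrow> bool" where
  "quasi_preserved G \<phi> M \<longleftrightarrow>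
     (\<forall>g\<in>carrier G. \<exists>c::real. \<forall>B\<in>sets borel.
        emeasure M (\<phi> g -` B) = ennreal c * emeasure M B)"

end

theory Submission
  imports Defs
begin

text \<open>
  A quotient of locally subexponential growth contains no free subsemigroup on two generators, so
  no two elements of \<open>N i\<close> play ping-pong on the line with endpoints fixed by \<open>N (i + 1)\<close>.
  Without ping-pong, the elements having a fixed point form a subgroup, and modulo this subgroup
  the pointwise order is an Archimedean bi-invariant order; Hoelder's theorem then yields a
  translation number \<open>t\<close>, and \<open>F x = inf {t h | h 0 > x}\<close> is the distribution function of an
  invariant measure.

  Let \<open>k\<close> be the largest index such that \<open>N k\<close> has no global fixed point.  The element \<open>T\<close> forces
  \<open>N k\<close> to contain a fixed-point-free element, so \<open>N k\<close> has a translation number. If its image is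
  dense in the reals, then \<open>F\<close> is unique up to affine maps, and \<open>G\<close>, which normalizes \<open>N k\<close>,
  acts on \<open>F\<close> by affine maps. Otherwise a generator \<open>e\<close> of the image is central for the action of
  \<open>G\<close> on the fixed set of the kernel; ping-pong for \<open>N (k - 1)\<close> would take place inside one
  fundamental domain of \<open>e\<close>, so \<open>N (k - 1)\<close> has a translation number as well, and one continues
  upwards until the image is dense or the whole group is reached.
\<close>

section \<open>Growth and coincidences of words\<close>

fun word_eval :: "('a, 'b) monoid_scheme \<Rightarrow> 'a \<Rightarrow> 'a \<Rightarrow> bool list \<Rightarrow> 'a" where
  "word_eval G f g [] = \<one>\<^bsub>G\<^esub>"
| "word_eval G f g (b # w) = (if b then f else g) \<otimes>\<^bsub>G\<^esub> word_eval G f g w"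

text \<open>Stated inside \<open>G\<close> rather than in the quotient, so that a coincidence can be
  applied directly to points of the line. Modulo a normal \<open>K\<close>, it excludes free
  subsemigroups on two elements of \<open>H\<close>. Equal lengths spare
  \<open>ping_pong_words\<close> the comparison of a word with its own prefix.\<close>

definition (in monoid) word_coincident :: "'a set \<Rightarrow> 'a set \<Rightarrow> bool" where
  "word_coincident H K \<longleftrightarrow> (\<forall>f\<in>H. \<forall>g\<in>H. \<exists>w w' k. length w = length w' \<and> w \<noteq> w' \<and> k \<in> K \<and>
     word_eval G f g w = word_eval G f g w' \<otimes> k)"

lemma (in group) word_eval_closed [simp]:
  "f \<in> carrier G \<Longrightarrow> g \<in> carrier G \<Longrightarrow> word_eval G f g w \<in> carrier G"
  by (induction w) auto

lemma word_eval_restrict [simp]: "word_eval (G\<lparr>carrier := H\<rparr>) f g w = word_eval G f g w"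
  by (induction w) auto

lemma (in subgroup) word_eval_closed [simp]:
  "f \<in> H \<Longrightarrow> g \<in> H \<Longrightarrow> word_eval G f g w \<in> H"
  by (induction w) auto

lemma hom_word_eval:
  assumes "h \<in> hom G Q" "group G" "group Q" "f \<in> carrier G" "g \<in> carrier G"
  shows "h (word_eval G f g w) = word_eval Q (h f) (h g) w"
proof -
  interpret group_hom G Q h
    using assms by (simp add: group_hom_def group_hom_axioms_def)
  show ?thesis
    using assms(4,5) by (induction w) auto
qed

section \<open>Balls in the word metric\<close>

lemma (in group) foldr_mult_append:
  assumes "set xs \<subseteq> carrier G" "set ys \<subseteq> carrier G"
  shows "foldr (\<otimes>) xs \<one> \<otimes> foldr (\<otimes>) ys \<one> = foldr (\<otimes>) (xs @ ys) \<one>"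
proof -
  have closed: "foldr (\<otimes>) zs \<one> \<in> carrier G" if "set zs \<subseteq> carrier G" for zs
    using that by (induction zs) auto
  show ?thesis
    using assms by (induction xs) (auto simp: m_assoc closed)
qed

lemma (in group) word_ball_mult:
  assumes "S \<subseteq> carrier G" "x \<in> word_ball G S m" "y \<in> word_ball G S n"
  shows "x \<otimes> y \<in> word_ball G S (m + n)"
proof -
  have *: "S \<union> m_inv G ` S \<subseteq> carrier G"
    using assms(1) by auto
  obtain xs ys where "x = foldr (\<otimes>) xs \<one>" "length xs \<le> m" "set xs \<subseteq> S \<union> m_inv G ` S"
    "y = foldr (\<otimes>) ys \<one>" "length ys \<le> n" "set ys \<subseteq> S \<union> m_inv G ` S"
    using assms(2,3) by (auto simp: word_ball_def)
  moreover from this have "x \<otimes> y = foldr (\<otimes>) (xs @ ys) \<one>"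
    using foldr_mult_append[of xs ys] * by (metis subset_trans)
  ultimately have "x \<otimes> y = foldr (\<otimes>) (xs @ ys) \<one>" "length (xs @ ys) \<le> m + n"
    "set (xs @ ys) \<subseteq> S \<union> m_inv G ` S"
    by auto
  then show ?thesis
    unfolding word_ball_def by blast
qed

lemma word_ball_mono: "m \<le> n \<Longrightarrow> word_ball G S m \<subseteq> word_ball G S n"
  unfolding word_ball_def by fastforce

lemma finite_word_ball:
  assumes "finite S" shows "finite (word_ball G S n)"
proof -
  have "finite {xs. set xs \<subseteq> S \<union> m_inv G ` S \<and> length xs \<le> n}"
    using assms by (intro finite_lists_length_le) auto
  then have "finite ((\<lambda>xs. foldr (\<otimes>\<^bsub>G\<^esub>) xs \<one>\<^bsub>G\<^esub>) ` {xs. set xs \<subseteq> S \<union> m_inv G ` S \<and> length xs \<le> n})"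
    by blast
  then show ?thesis
    by (rule rev_finite_subset) (auto simp: word_ball_def)
qed

lemma (in group) generate_in_word_ball:
  assumes "S \<subseteq> carrier G" "x \<in> generate G S"
  shows "\<exists>n. x \<in> word_ball G S n"
  using assms(2)
proof (induction rule: generate.induct)
  case one
  have "foldr (\<otimes>) [] \<one> \<in> word_ball G S 0"
    unfolding word_ball_def by fastforce
  then show ?case by auto
next
  case (incl h)
  then have "foldr (\<otimes>) [h] \<one> \<in> word_ball G S 1"
    unfolding word_ball_def by (intro CollectI exI[of _ "[h]"]) auto
  moreover have "h \<in> carrier G" using incl assms(1) by auto
  ultimately show ?case by (metis foldr.simps comp_apply id_apply r_one)
next
  case (inv h)
  then have "foldr (\<otimes>) [inv h] \<one> \<in> word_ball G S 1"
    unfolding word_ball_def by (intro CollectI exI[of _ "[inv h]"]) auto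
  moreover have "inv h \<in> carrier G" using inv assms(1) by auto
  ultimately show ?case by (metis foldr.simps comp_apply id_apply r_one)
next
  case (eng h1 h2)
  then show ?case using word_ball_mult[OF assms(1)] by blast
qed

text \<open>If all words of length \<open>n\<close> in \<open>f\<close> and \<open>g\<close> had
  different values, the ball of radius \<open>L * n\<close> would contain at least
  \<open>2 ^ n\<close> elements, and the growth rate along the multiples of \<open>L\<close> would
  be at least \<open>ln 2 / L\<close>.\<close>

lemma (in group) subexp_growth_word_coincidence:
  assumes "has_subexp_growth G" "f \<in> carrier G" "g \<in> carrier G"
  shows "\<exists>w w'. length w = length w' \<and> w \<noteq> w' \<and> word_eval G f g w = word_eval G f g w'"
proof (rule ccontr)
  assume contra: "\<not> ?thesis"
  obtain S where S: "finite S" "S \<subseteq> carrier G" "generate G S = carrier G" "subexp_growth_wrt G S"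
    using assms(1) by (auto simp: has_subexp_growth_def)
  obtain m n where fg: "f \<in> word_ball G S m" "g \<in> word_ball G S n"
    using generate_in_word_ball[OF S(2)] S(3) assms(2,3) by metis
  \<comment> \<open>The ball of this radius contains both \<open>f\<close> and \<open>g\<close>; the
    successor makes \<open>L\<close> positive, so that \<open>L * n\<close> runs through a
    subsequence of the radii.\<close>
  define L where "L = Suc (max m n)"
  have "0 < L" by (simp add: L_def)
  have fL: "f \<in> word_ball G S L" and gL: "g \<in> word_ball G S L"
    using fg word_ball_mono[of m L G S] word_ball_mono[of n L G S] by (auto simp: L_def le_SucI)
  have ball: "word_eval G f g w \<in> word_ball G S (L * length w)" for w
  proof (induction w)
    case Nil
    have "foldr (\<otimes>) [] \<one> \<in> word_ball G S 0"
      unfolding word_ball_def by fastforce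
    then show ?case by simp
  next
    case (Cons b w)
    have "(if b then f else g) \<in> word_ball G S L" using fL gL by simp
    from word_ball_mult[OF S(2) this Cons] show ?case by simp
  qed
  have card: "2 ^ n \<le> card (word_ball G S (L * n))" for n
  proof -
    let ?W = "{w. set w \<subseteq> (UNIV :: bool set) \<and> length w = n}"
    have "inj_on (word_eval G f g) ?W"
      using contra unfolding inj_on_def by fastforce
    then have "card ?W = card (word_eval G f g ` ?W)"
      by (simp add: card_image)
    also have "\<dots> \<le> card (word_ball G S (L * n))"
      by (intro card_mono finite_word_ball S) (use ball in auto)
    finally show ?thesis
      by (subst (asm) card_lists_length_eq) auto
  qed
  have "filterlim (\<lambda>n. L * n) sequentially sequentially"
    by (rule filterlim_subseq) (use \<open>0 < L\<close> in \<open>auto simp: strict_mono_def\<close>)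
  with S(4) have "(\<lambda>n. ln (real (card (word_ball G S (L * n)))) / real (L * n)) \<longlonglongrightarrow> 0"
    unfolding subexp_growth_wrt_def by (rule filterlim_compose)
  moreover have "ln 2 / real L \<le> ln (real (card (word_ball G S (L * n)))) / real (L * n)" if "n \<ge> 1" for n
  proof -
    have "real n * ln 2 = ln (2 ^ n)" by (simp add: ln_realpow)
    also have "(2 ^ n :: real) \<le> real (card (word_ball G S (L * n)))"
      using card[of n] by (metis of_nat_le_iff of_nat_numeral of_nat_power)
    then have "ln (2 ^ n) \<le> ln (real (card (word_ball G S (L * n))))"
      by (subst ln_le_cancel_iff) (auto intro: less_le_trans[of 0 "2 ^ n"])
    finally show ?thesis
      using that \<open>0 < L\<close> by (simp add: field_simps)
  qed
  ultimately have "ln 2 / real L \<le> 0"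
    by (intro tendsto_lowerbound[of _ 0 sequentially "ln 2 / real L"]) (auto intro: eventually_sequentiallyI[of 1])
  then show False
    by (simp add: L_def divide_le_0_iff)
qed

text \<open>Growth is applied to the subgroup of the quotient generated by the two cosets; equal
  words of cosets lift to words of \<open>G\<close> that differ by a factor from
  \<open>K\<close>.\<close>

lemma (in group) word_coincident_if_locally_subexp_growth:
  assumes "H \<lhd> G" "K \<lhd> G" "K \<subseteq> H" "locally_subexp_growth (G\<lparr>carrier := H\<rparr> Mod K)"
  shows "word_coincident H K"
  unfolding word_coincident_def
proof (intro ballI)
  fix f g assume fg: "f \<in> H" "g \<in> H"
  let ?H = "G\<lparr>carrier := H\<rparr>"
  let ?Q = "?H Mod K"
  let ?c = "\<lambda>a. K #>\<^bsub>?H\<^esub> a"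
  interpret H: subgroup H G using assms(1) by (rule normal_imp_subgroup)
  interpret HG: group ?H by (rule H.subgroup_is_group) (rule group_axioms)
  interpret K: normal K ?H
    using normal_restrict_supergroup[OF H.subgroup_axioms assms(2,3)] .
  interpret Q: group ?Q by (rule K.factorgroup_is_group)
  have hom: "?c \<in> hom ?H ?Q" by (rule K.r_coset_hom_Mod)
  define S where "S = {?c f, ?c g}"
  have S: "S \<subseteq> carrier ?Q"
    using hom fg by (auto simp: S_def hom_def)
  let ?R = "?Q\<lparr>carrier := generate ?Q S\<rparr>"
  have growth: "has_subexp_growth ?R"
    using assms(4) S by (auto simp: locally_subexp_growth_def S_def)
  interpret R: group ?R
    by (rule subgroup.subgroup_is_group[OF Q.generate_is_subgroup[OF S] Q.group_axioms])
  obtain w w' where w: "length w = length w'" "w \<noteq> w'"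
    "word_eval ?R (?c f) (?c g) w = word_eval ?R (?c f) (?c g) w'"
    using R.subexp_growth_word_coincidence[OF growth, of "?c f" "?c g"]
    by (auto simp: S_def intro: generate.incl)
  have ev: "word_eval ?R (?c f) (?c g) v = ?c (word_eval ?H f g v)" for v
    unfolding word_eval_restrict[where G = ?Q]
    by (rule hom_word_eval[OF hom HG.group_axioms Q.group_axioms, symmetric]) (use fg in auto)
  have cl: "word_eval G f g v \<in> H" for v
    using fg by simp
  have "word_eval ?H f g w \<in> ?c (word_eval ?H f g w)"
    by (rule HG.rcos_self[OF _ K.subgroup_axioms]) (use cl in simp)
  also have "\<dots> = ?c (word_eval ?H f g w')"
    using w(3) unfolding ev .
  \<comment> \<open>The left coset puts the discrepancy \<open>k\<close> to the right of the word,
    where it acts first on a point and disappears if \<open>K\<close> fixes that point.\<close>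
  also have "\<dots> = word_eval ?H f g w' <#\<^bsub>?H\<^esub> K"
    using K.coset_eq cl by simp
  finally obtain k where "k \<in> K" "word_eval G f g w = word_eval G f g w' \<otimes> k"
    by (auto simp: l_coset_def)
  then show "\<exists>w w' k. length w = length w' \<and> w \<noteq> w' \<and> k \<in> K \<and>
      word_eval G f g w = word_eval G f g w' \<otimes> k"
    using w by blast
qed

section \<open>Archimedean ordered groups\<close>

text \<open>Replacing a factor \<open>x \<otimes> y\<close> by \<open>y \<otimes> x\<close> moves a
  product up in \<open>R\<close>. Such swaps lead from \<open>x [^] n \<otimes> y [^] n\<close> to
  \<open>(x \<otimes> y) [^] n\<close> and on to \<open>y [^] n \<otimes> x [^] n\<close>. The
  relation is abstract because both \<open>le\<close> and its converse are inserted for it.\<close>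

lemma (in group) pow_mult_sorted:
  fixes R :: "'a \<Rightarrow> 'a \<Rightarrow> bool"
  assumes refl: "\<And>a. a \<in> carrier G \<Longrightarrow> R a a"
    and trans: "\<And>a b c. \<lbrakk>a \<in> carrier G; b \<in> carrier G; c \<in> carrier G; R a b; R b c\<rbrakk> \<Longrightarrow> R a c"
    and left: "\<And>a b c. \<lbrakk>a \<in> carrier G; b \<in> carrier G; c \<in> carrier G; R a b\<rbrakk> \<Longrightarrow> R (c \<otimes> a) (c \<otimes> b)"
    and right: "\<And>a b c. \<lbrakk>a \<in> carrier G; b \<in> carrier G; c \<in> carrier G; R a b\<rbrakk> \<Longrightarrow> R (a \<otimes> c) (b \<otimes> c)"
    and [simp]: "x \<in> carrier G" "y \<in> carrier G" and R: "R (x \<otimes> y) (y \<otimes> x)"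
  shows "R (x [^] (n::nat) \<otimes> y [^] n) ((x \<otimes> y) [^] n)"
    and "R ((x \<otimes> y) [^] n) (y [^] n \<otimes> x [^] n)"
proof -
  have comm: "R (x [^] (k::nat) \<otimes> y) (y \<otimes> x [^] k)" for k
  proof (induction k)
    case (Suc k)
    have "R (x [^] k \<otimes> (x \<otimes> y)) (x [^] k \<otimes> (y \<otimes> x))"
      using R by (intro left) auto
    moreover have "R (x [^] k \<otimes> y \<otimes> x) (y \<otimes> x [^] k \<otimes> x)"
      using Suc by (intro right) auto
    ultimately show ?case
      using trans[of "x [^] k \<otimes> (x \<otimes> y)" "x [^] k \<otimes> (y \<otimes> x)" "y \<otimes> x [^] k \<otimes> x"]
      by (simp add: m_assoc)
  qed (simp add: refl)
  have comm': "R (x \<otimes> y [^] (k::nat)) (y [^] k \<otimes> x)" for k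
  proof (induction k)
    case (Suc k)
    have "R (y [^] k \<otimes> (x \<otimes> y)) (y [^] k \<otimes> (y \<otimes> x))"
      using R by (intro left) auto
    moreover have "R (x \<otimes> y [^] k \<otimes> y) (y [^] k \<otimes> x \<otimes> y)"
      using Suc by (intro right) auto
    ultimately show ?case
      using trans[of "x \<otimes> y [^] k \<otimes> y" "y [^] k \<otimes> x \<otimes> y" "y [^] k \<otimes> (y \<otimes> x)"]
      by (simp add: m_assoc)
  qed (simp add: refl)
  show "R (x [^] n \<otimes> y [^] n) ((x \<otimes> y) [^] n)"
  proof (induction n)
    case (Suc n)
    have "R (x [^] n \<otimes> (x \<otimes> y [^] n) \<otimes> y) (x [^] n \<otimes> (y [^] n \<otimes> x) \<otimes> y)"
      by (intro right left comm') auto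
    moreover have "R (x [^] n \<otimes> y [^] n \<otimes> (x \<otimes> y)) ((x \<otimes> y) [^] n \<otimes> (x \<otimes> y))"
      using Suc by (intro right) auto
    ultimately show ?case
      using trans[of "x [^] n \<otimes> (x \<otimes> y [^] n) \<otimes> y" "x [^] n \<otimes> (y [^] n \<otimes> x) \<otimes> y" "(x \<otimes> y) [^] n \<otimes> (x \<otimes> y)"]
      by (simp add: m_assoc)
  qed (simp add: refl)
  show "R ((x \<otimes> y) [^] n) (y [^] n \<otimes> x [^] n)"
  proof (induction n)
    case (Suc n)
    have "R (y [^] n \<otimes> (x [^] n \<otimes> (x \<otimes> y))) (y [^] n \<otimes> (y \<otimes> (x [^] n \<otimes> x)))"
      using comm[of "Suc n"] by (intro left) (auto simp: m_assoc)
    moreover have "R ((x \<otimes> y) [^] n \<otimes> (x \<otimes> y)) (y [^] n \<otimes> x [^] n \<otimes> (x \<otimes> y))"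
      using Suc by (intro right) auto
    ultimately show ?case
      using trans[of "(x \<otimes> y) [^] n \<otimes> (x \<otimes> y)" "y [^] n \<otimes> (x [^] n \<otimes> (x \<otimes> y))" "y [^] n \<otimes> (y \<otimes> (x [^] n \<otimes> x))"]
      by (simp add: m_assoc)
  qed (simp add: refl)
qed

text \<open>Incomparable elements may be distinct; \<open>not_lt_trans\<close> makes incomparability
  an equivalence. This is an Archimedean ordered group modulo the elements incomparable to
  \<open>\<one>\<close>, described without forming the quotient.\<close>

locale archimedean_ordered_group = group G for G (structure) +
  fixes lt :: "'a \<Rightarrow> 'a \<Rightarrow> bool"
  assumes lt_irrefl: "x \<in> carrier G \<Longrightarrow> \<not> lt x x"
    and lt_trans: "\<lbrakk>x \<in> carrier G; y \<in> carrier G; z \<in> carrier G; lt x y; lt y z\<rbrakk> \<Longrightarrow> lt x z"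
    and not_lt_trans: "\<lbrakk>x \<in> carrier G; y \<in> carrier G; z \<in> carrier G; \<not> lt x y; \<not> lt y z\<rbrakk> \<Longrightarrow> \<not> lt x z"
    and lt_mult_left: "\<lbrakk>x \<in> carrier G; y \<in> carrier G; z \<in> carrier G; lt x y\<rbrakk> \<Longrightarrow> lt (z \<otimes> x) (z \<otimes> y)"
    and lt_mult_right: "\<lbrakk>x \<in> carrier G; y \<in> carrier G; z \<in> carrier G; lt x y\<rbrakk> \<Longrightarrow> lt (x \<otimes> z) (y \<otimes> z)"
    and archimedean: "\<lbrakk>x \<in> carrier G; y \<in> carrier G; lt \<one> x\<rbrakk> \<Longrightarrow> \<exists>n::nat. lt y (x [^] n)"
begin

section \<open>Total preorder and comparison of powers\<close>

definition le where "le x y \<longleftrightarrow> \<not> lt y x"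

lemma le_refl: "x \<in> carrier G \<Longrightarrow> le x x"
  using lt_irrefl by (simp add: le_def)

lemma le_trans: "\<lbrakk>x \<in> carrier G; y \<in> carrier G; z \<in> carrier G; le x y; le y z\<rbrakk> \<Longrightarrow> le x z"
  using not_lt_trans unfolding le_def by blast

lemma lt_imp_le: "\<lbrakk>x \<in> carrier G; y \<in> carrier G; lt x y\<rbrakk> \<Longrightarrow> le x y"
  using lt_trans lt_irrefl unfolding le_def by blast

lemma lt_le_trans: "\<lbrakk>x \<in> carrier G; y \<in> carrier G; z \<in> carrier G; lt x y; le y z\<rbrakk> \<Longrightarrow> lt x z"
  using not_lt_trans[of x z y] unfolding le_def by blast

lemma le_mult_left:
  assumes "x \<in> carrier G" "y \<in> carrier G" "z \<in> carrier G" "le x y"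
  shows "le (z \<otimes> x) (z \<otimes> y)"
  using lt_mult_left[of "z \<otimes> y" "z \<otimes> x" "inv z"] assms by (auto simp: le_def m_assoc[symmetric])

lemma le_mult_right:
  assumes "x \<in> carrier G" "y \<in> carrier G" "z \<in> carrier G" "le x y"
  shows "le (x \<otimes> z) (y \<otimes> z)"
  using lt_mult_right[of "y \<otimes> z" "x \<otimes> z" "inv z"] assms by (auto simp: le_def m_assoc)

lemma le_mult:
  assumes "x \<in> carrier G" "y \<in> carrier G" "x' \<in> carrier G" "y' \<in> carrier G" "le x y" "le x' y'"
  shows "le (x \<otimes> x') (y \<otimes> y')"
  using le_trans[OF _ _ _ le_mult_right[of x y x'] le_mult_left[of x' y' y]] assms by simp

lemma lt_mult:
  assumes "x \<in> carrier G" "y \<in> carrier G" "x' \<in> carrier G" "y' \<in> carrier G" "lt x y" "lt x' y'"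
  shows "lt (x \<otimes> x') (y \<otimes> y')"
  using lt_trans[OF _ _ _ lt_mult_right[of x y x'] lt_mult_left[of x' y' y]] assms by simp

lemma le_pow: "\<lbrakk>x \<in> carrier G; y \<in> carrier G; le x y\<rbrakk> \<Longrightarrow> le (x [^] (n::nat)) (y [^] n)"
  by (induction n) (auto intro: le_mult le_refl)

lemma lt_pow: "\<lbrakk>x \<in> carrier G; y \<in> carrier G; lt x y; 0 < n\<rbrakk> \<Longrightarrow> lt (x [^] (n::nat)) (y [^] n)"
proof (induction n)
  case (Suc n)
  then show ?case by (cases "n = 0") (auto intro: lt_mult)
qed simp

lemma lt_int_pow:
  assumes [simp]: "e \<in> carrier G" and "lt \<one> e" "m < (m'::int)"
  shows "lt (e [^] m) (e [^] m')"
proof -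
  obtain k where k: "m' = m + int (Suc k)"
    using assms(3) by (metis add.commute add_Suc_right zless_iff_Suc_zadd)
  have "lt (\<one> [^] Suc k) (e [^] Suc k)"
    using assms(2) by (intro lt_pow) auto
  then have "lt \<one> (e [^] int (Suc k))"
    by (metis int_pow_int nat_pow_one)
  from lt_mult_left[OF _ _ _ this, of "e [^] m"] show ?thesis
    by (simp add: k int_pow_mult)
qed

lemma lt_int_pow_iff:
  assumes "e \<in> carrier G" "lt \<one> e"
  shows "lt (e [^] m) (e [^] m') \<longleftrightarrow> m < (m'::int)"
  using lt_int_pow[OF assms, of m m'] lt_int_pow[OF assms, of m' m] lt_irrefl lt_trans assms
  by (metis int_pow_closed linorder_neqE_linordered_idom)

text \<open>Raising the two comparisons to the powers \<open>n'\<close> and \<open>n\<close> makes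
  both of them comparisons with \<open>h [^] (n * n')\<close>, after which the exponents of
  \<open>e\<close> can be compared.\<close>

lemma int_pow_cut:
  assumes [simp]: "e \<in> carrier G" "h \<in> carrier G" and "lt \<one> e"
    and "lt (e [^] (m::int)) (h [^] (n::nat))" "le (h [^] (n'::nat)) (e [^] (m'::int))" "0 < n" "0 < n'"
  shows "real_of_int m / real n < real_of_int m' / real n'"
proof -
  have "lt ((e [^] m) [^] n') ((h [^] n) [^] n')"
    using assms by (intro lt_pow) auto
  moreover have "le ((h [^] n') [^] n) ((e [^] m') [^] n)"
    using assms by (intro le_pow) auto
  moreover have "(h [^] n) [^] n' = (h [^] n') [^] n"
    by (simp add: nat_pow_pow mult.commute)
  ultimately have "lt ((e [^] m) [^] n') ((e [^] m') [^] n)"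
    using lt_le_trans[of "(e [^] m) [^] n'" "(h [^] n) [^] n'" "(e [^] m') [^] n"] by simp
  then have "lt (e [^] (m * int n')) (e [^] (m' * int n))"
    by (metis int_pow_int int_pow_pow assms(1))
  then have "m * int n' < m' * int n"
    using assms by (simp add: lt_int_pow_iff)
  then have "real_of_int (m * int n') < real_of_int (m' * int n)"
    by linarith
  then show ?thesis
    using assms by (simp add: field_simps)
qed

text \<open>A Dedekind cut: the fractions \<open>m / n\<close> below the logarithm of
  \<open>h\<close> to the base \<open>e\<close>. Its supremum will be the translation number of
  \<open>h\<close> with \<open>e\<close> as the unit.\<close>

definition cut :: "'a \<Rightarrow> 'a \<Rightarrow> real set" where
  "cut e h = {real_of_int m / real n | m n. 0 < n \<and> lt (e [^] (m::int)) (h [^] (n::nat))}"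

lemma
  assumes [simp]: "e \<in> carrier G" "h \<in> carrier G" and "lt \<one> e"
  shows cut_nonempty: "cut e h \<noteq> {}" and bdd_above_cut: "bdd_above (cut e h)"
proof -
  \<comment> \<open>A power of \<open>e\<close> above \<open>inv h\<close> gives
    \<open>e [^] (- int n)\<close> below \<open>h\<close>, hence an integer in the cut.\<close>
  obtain n :: nat where "lt (inv h) (e [^] n)"
    using archimedean[of e "inv h"] assms by auto
  from lt_mult_left[OF _ _ _ this, of h] have "lt \<one> (h \<otimes> e [^] n)" by simp
  from lt_mult_right[OF _ _ _ this, of "inv (e [^] n)"] have "lt (e [^] (- int n)) (h [^] (1::nat))"
    by (simp add: m_assoc int_pow_neg_int)
  then show "cut e h \<noteq> {}"
    unfolding cut_def by (metis (mono_tags, lifting) empty_iff mem_Collect_eq zero_less_one)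
  obtain k :: nat where "lt h (e [^] k)"
    using archimedean[of e h] assms by auto
  then have "le (h [^] (1::nat)) (e [^] int k)"
    by (simp add: int_pow_int lt_imp_le)
  then have "x \<le> real_of_int (int k) / real 1" if "x \<in> cut e h" for x
    using that int_pow_cut[OF assms(1,2,3), of _ _ 1 "int k"] unfolding cut_def by force
  then show "bdd_above (cut e h)"
    by (rule bdd_aboveI)
qed

lemma le_Sup_cut:
  assumes "e \<in> carrier G" "h \<in> carrier G" "lt \<one> e" "0 < n" "lt (e [^] (m::int)) (h [^] (n::nat))"
  shows "real_of_int m / real n \<le> Sup (cut e h)"
  using bdd_above_cut[OF assms(1-3)] assms(4,5) by (intro cSup_upper) (auto simp: cut_def)

text \<open>Were the comparison false, \<open>int_pow_cut\<close> would make \<open>m / n\<close> an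
  upper bound of the cut.\<close>

lemma less_Sup_cut:
  assumes "e \<in> carrier G" "h \<in> carrier G" "lt \<one> e" "0 < n" "real_of_int m / real n < Sup (cut e h)"
  shows "lt (e [^] (m::int)) (h [^] (n::nat))"
proof (rule ccontr)
  assume "\<not> ?thesis"
  then have le: "le (h [^] n) (e [^] m)" by (simp add: le_def)
  have "Sup (cut e h) \<le> real_of_int m / real n"
    using int_pow_cut[OF assms(1-3) _ le] assms(4)
    by (intro cSup_least cut_nonempty[OF assms(1-3)]) (force simp: cut_def)
  with assms(5) show False by simp
qed

text \<open>
  Commutativity is not assumed: whichever of \<open>x \<otimes> y\<close> and \<open>y \<otimes> x\<close> is smaller, the power
  \<open>(x \<otimes> y) [^] n\<close> lies between the two products of \<open>x [^] n\<close> and \<open>y [^] n\<close>.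
\<close>

lemma Sup_cut_mult:
  assumes [simp]: "e \<in> carrier G" "x \<in> carrier G" "y \<in> carrier G" and e: "lt \<one> e"
  shows "Sup (cut e (x \<otimes> y)) = Sup (cut e x) + Sup (cut e y)"
proof -
  let ?t = "\<lambda>h. Sup (cut e h)"
  have "\<exists>a b. {a, b} = {x, y} \<and> (\<forall>n::nat. le (a [^] n \<otimes> b [^] n) ((x \<otimes> y) [^] n))
      \<and> (\<forall>n::nat. le ((x \<otimes> y) [^] n) (b [^] n \<otimes> a [^] n))"
  proof (cases "le (x \<otimes> y) (y \<otimes> x)")
    case True
    note sorted = pow_mult_sorted[of le x y, OF le_refl le_trans le_mult_left le_mult_right assms(2,3) True]
    show ?thesis
      by (intro exI[of _ x] exI[of _ y] conjI allI sorted refl)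
  next
    case False
    then have yx: "le (y \<otimes> x) (x \<otimes> y)"
      by (simp add: le_def lt_imp_le[unfolded le_def])
    note sorted = pow_mult_sorted[of "\<lambda>a b. le b a" x y, OF le_refl _ le_mult_left le_mult_right assms(2,3) yx]
    show ?thesis
      by (intro exI[of _ y] exI[of _ x] conjI allI sorted) (auto intro: le_trans)
  qed
  then obtain a b where ab: "{a, b} = {x, y}"
    and lo: "\<And>n::nat. le (a [^] n \<otimes> b [^] n) ((x \<otimes> y) [^] n)"
    and hi: "\<And>n::nat. le ((x \<otimes> y) [^] n) (b [^] n \<otimes> a [^] n)"
    by blast
  have [simp]: "a \<in> carrier G" "b \<in> carrier G" using ab by (auto simp: doubleton_eq_iff)
  have sum: "?t a + ?t b = ?t x + ?t y"
    using ab by (auto simp: doubleton_eq_iff)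
  \<comment> \<open>Rounding the two translation numbers, scaled by \<open>Suc k\<close>, to integer
    exponents costs at most \<open>2\<close> in total, hence \<open>2 / Suc k\<close> after
    division; \<open>k\<close> is arbitrary.\<close>
  have "\<bar>?t (x \<otimes> y) - (?t a + ?t b)\<bar> \<le> 2 * inverse (real (Suc k))" for k
  proof -
    let ?n = "Suc k"
    \<comment> \<open>The greatest integer strictly below and the least strictly above
      \<open>real ?n * ?t h\<close>: the supremum of the cut decides a comparison only when the
      inequality is strict.\<close>
    let ?lo = "\<lambda>h. \<lceil>real ?n * ?t h\<rceil> - 1" and ?hi = "\<lambda>h. \<lfloor>real ?n * ?t h\<rfloor> + 1"
    have l: "lt (e [^] ?lo h) (h [^] ?n)" if "h \<in> carrier G" for h
    proof (rule less_Sup_cut)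
      show "real_of_int (?lo h) / real ?n < ?t h"
        by (simp add: field_simps) linarith
    qed (use e that in auto)
    have "real_of_int (?lo a + ?lo b) / real ?n \<le> ?t (x \<otimes> y)"
    proof (rule le_Sup_cut)
      have "lt (e [^] ?lo a \<otimes> e [^] ?lo b) (a [^] ?n \<otimes> b [^] ?n)"
        by (rule lt_mult[OF _ _ _ _ l l]) auto
      then show "lt (e [^] (?lo a + ?lo b)) ((x \<otimes> y) [^] ?n)"
        unfolding int_pow_mult[OF assms(1)] by (rule lt_le_trans[OF _ _ _ _ lo, rotated 3]) auto
    qed (use e in auto)
    moreover have u: "le (h [^] ?n) (e [^] ?hi h)" if "h \<in> carrier G" for h
      unfolding le_def
    proof
      assume "lt (e [^] ?hi h) (h [^] ?n)"
      from le_Sup_cut[OF _ that e _ this] show False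
        by (simp add: field_simps) linarith
    qed
    have "?t (x \<otimes> y) \<le> real_of_int (?hi b + ?hi a) / real ?n"
    proof (rule ccontr)
      assume "\<not> ?thesis"
      then have "lt (e [^] (?hi b + ?hi a)) ((x \<otimes> y) [^] ?n)"
        by (intro less_Sup_cut) (use e in auto)
      moreover have "le (b [^] ?n \<otimes> a [^] ?n) (e [^] ?hi b \<otimes> e [^] ?hi a)"
        by (rule le_mult[OF _ _ _ _ u u]) auto
      then have "le ((x \<otimes> y) [^] ?n) (e [^] (?hi b + ?hi a))"
        unfolding int_pow_mult[OF assms(1)] by (rule le_trans[OF _ _ _ hi, rotated 3]) auto
      ultimately show False by (simp add: le_def)
    qed
    moreover have "(real ?n * ?t a + real ?n * ?t b - 2) / real ?n \<le> real_of_int (?lo a + ?lo b) / real ?n"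
      by (intro divide_right_mono) linarith+
    moreover have "real_of_int (?hi b + ?hi a) / real ?n \<le> (real ?n * ?t a + real ?n * ?t b + 2) / real ?n"
      by (intro divide_right_mono) linarith+
    moreover have "(real ?n * ?t a + real ?n * ?t b + c) / real ?n = ?t a + ?t b + c * inverse (real ?n)" for c
      by (simp add: field_simps del: of_nat_Suc)
    from this[of 2] this[of "- 2"]
    have "(real ?n * ?t a + real ?n * ?t b + 2) / real ?n = ?t a + ?t b + 2 * inverse (real ?n)"
      "(real ?n * ?t a + real ?n * ?t b - 2) / real ?n = ?t a + ?t b - 2 * inverse (real ?n)"
      by simp_all
    ultimately show ?thesis by linarith
  qed
  then have "\<bar>?t (x \<otimes> y) - (?t a + ?t b)\<bar> \<le> 2 * 0"
    by (intro LIMSEQ_le_const[OF tendsto_mult[OF tendsto_const LIMSEQ_inverse_real_of_nat]]) auto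
  then show ?thesis using sum by simp
qed

text \<open>The homomorphism is \<open>Sup (cut e x)\<close>. Some power of a positive
  \<open>x\<close> exceeds \<open>e\<close>, which puts a positive fraction \<open>1 / n\<close>
  into its cut.\<close>

theorem hoelder:
  assumes e: "e \<in> carrier G" "lt \<one> e"
  obtains t :: "'a \<Rightarrow> real" where
    "\<And>x y. x \<in> carrier G \<Longrightarrow> y \<in> carrier G \<Longrightarrow> t (x \<otimes> y) = t x + t y"
    "\<And>x. x \<in> carrier G \<Longrightarrow> 0 < t x \<longleftrightarrow> lt \<one> x"
proof
  show "Sup (cut e (x \<otimes> y)) = Sup (cut e x) + Sup (cut e y)" if "x \<in> carrier G" "y \<in> carrier G" for x y
    using Sup_cut_mult that e by simp
  show "0 < Sup (cut e x) \<longleftrightarrow> lt \<one> x" if x: "x \<in> carrier G" for x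
  proof
    assume "0 < Sup (cut e x)"
    then have "lt (e [^] (0::int)) (x [^] (1::nat))"
      by (intro less_Sup_cut) (use e x in auto)
    then show "lt \<one> x" using x by simp
  next
    assume "lt \<one> x"
    then obtain n :: nat where n: "lt e (x [^] n)"
      using archimedean e x by blast
    have "n \<noteq> 0"
    proof
      assume "n = 0"
      with n have "lt e \<one>" by simp
      with e show False using lt_irrefl lt_trans[of e \<one> e] by auto
    qed
    have "real_of_int 1 / real n \<le> Sup (cut e x)"
      by (rule le_Sup_cut) (use e x n \<open>n \<noteq> 0\<close> in auto)
    then show "0 < Sup (cut e x)"
      using \<open>n \<noteq> 0\<close> by (auto intro: less_le_trans[of 0 "1 / real n"])
  qed
qed

end

section \<open>Order-preserving actions on the line\<close>

lemma (in group) subgroup_nat_pow_closed: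
  "subgroup H G \<Longrightarrow> x \<in> H \<Longrightarrow> x [^] (n::nat) \<in> H"
  using subgroup_int_pow_closed[of H x "int n"] by (simp add: int_pow_int)

text \<open>The bounded increasing orbit converges; continuity makes its limit a fixed point, and
  closedness keeps the limit in \<open>E\<close>. The last two conjuncts record the convergence in
  terms of the order.\<close>

lemma iterate_limit_up:
  fixes f :: "real \<Rightarrow> real"
  assumes "mono f" "continuous_on UNIV f" "closed E" "\<And>x. x \<in> E \<Longrightarrow> f x \<in> E"
    and x: "x \<in> E" "x \<le> f x" and B: "\<And>n. (f ^^ n) x \<le> B"
  shows "\<exists>c\<in>E. f c = c \<and> c \<le> B \<and> (\<forall>n. (f ^^ n) x \<le> c) \<and> (\<forall>y<c. \<exists>n. y < (f ^^ n) x)"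
proof -
  let ?X = "\<lambda>n. (f ^^ n) x"
  have "incseq ?X"
  proof (rule incseq_SucI)
    show "?X n \<le> ?X (Suc n)" for n
      by (induction n) (use x assms(1) in \<open>auto dest: monoD\<close>)
  qed
  then obtain c where lim: "?X \<longlonglongrightarrow> c" and le: "\<And>n. ?X n \<le> c"
    using incseq_convergent[of ?X B] B by blast
  have E: "?X n \<in> E" for n
    by (induction n) (use x assms(4) in auto)
  have "c \<in> E"
    using closed_sequentially[OF assms(3) E lim] .
  moreover have "(\<lambda>n. f (?X n)) \<longlonglongrightarrow> f c"
    by (rule continuous_on_tendsto_compose[OF assms(2) lim]) auto
  then have "f c = c"
    using LIMSEQ_Suc[OF lim] by (auto intro: LIMSEQ_unique)
  moreover have "c \<le> B"
    using lim B by (intro LIMSEQ_le_const2[OF lim]) auto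
  moreover have "\<exists>n. y < ?X n" if "y < c" for y
    using order_tendstoD(1)[OF lim that] by (auto simp: eventually_sequentially)
  ultimately show ?thesis
    using le by blast
qed

lemma iterate_limit_down:
  fixes f :: "real \<Rightarrow> real"
  assumes "mono f" "continuous_on UNIV f" "closed E" "\<And>x. x \<in> E \<Longrightarrow> f x \<in> E"
    and x: "x \<in> E" "f x \<le> x" and B: "\<And>n. B \<le> (f ^^ n) x"
  shows "\<exists>c\<in>E. f c = c \<and> B \<le> c \<and> (\<forall>n. c \<le> (f ^^ n) x) \<and> (\<forall>y>c. \<exists>n. (f ^^ n) x < y)"
proof -
  \<comment> \<open>Conjugation by negation turns the decreasing orbit into an increasing
    one.\<close>
  let ?g = "\<lambda>x. - f (- x)"
  have iter: "(?g ^^ n) (- x) = - (f ^^ n) x" for n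
    by (induction n) auto
  have "mono ?g"
    using assms(1) by (auto simp: mono_def)
  moreover have "continuous_on UNIV ?g"
    by (intro continuous_intros continuous_on_compose2[OF assms(2)]) auto
  moreover have "closed (uminus ` E)"
    using assms(3) by (rule closed_negations)
  moreover have "?g y \<in> uminus ` E" if "y \<in> uminus ` E" for y
    using that assms(4) by auto
  ultimately have "\<exists>c\<in>uminus ` E. ?g c = c \<and> c \<le> - B \<and> (\<forall>n. - (f ^^ n) x \<le> c) \<and>
      (\<forall>y<c. \<exists>n. y < - (f ^^ n) x)"
    unfolding iter[symmetric] by (intro iterate_limit_up) (use x B iter in auto)
  then obtain c where c: "c \<in> E" "f c = c" "B \<le> c" "\<And>n. c \<le> (f ^^ n) x"
    "\<And>y. y < - c \<Longrightarrow> \<exists>n. y < - (f ^^ n) x"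
    by force
  then have "\<exists>n. (f ^^ n) x < y" if "c < y" for y
    using c(5)[of "- y"] that by auto
  with c show ?thesis by blast
qed

section \<open>Actions on the line by increasing homeomorphisms\<close>

locale line_action = group G for G (structure) +
  fixes \<phi> :: "'a \<Rightarrow> real \<Rightarrow> real"
  assumes action: "order_pres_action G \<phi>"
begin

lemma act_one [simp]: "\<phi> \<one> x = x"
  using action by (simp add: order_pres_action_def)

lemma act_mult [simp]: "g \<in> carrier G \<Longrightarrow> h \<in> carrier G \<Longrightarrow> \<phi> (g \<otimes> h) x = \<phi> g (\<phi> h x)"
  using action by (simp add: order_pres_action_def)

lemma act_inv [simp]:
  assumes "g \<in> carrier G"
  shows "\<phi> (inv g) (\<phi> g x) = x" "\<phi> g (\<phi> (inv g) x) = x"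
  using act_mult[of "inv g" g x] act_mult[of g "inv g" x] assms by (simp_all del: act_mult)

lemma act_less_iff [simp]: "g \<in> carrier G \<Longrightarrow> \<phi> g x < \<phi> g y \<longleftrightarrow> x < y"
  using action by (simp add: order_pres_action_def strict_mono_less)

lemma act_le_iff [simp]: "g \<in> carrier G \<Longrightarrow> \<phi> g x \<le> \<phi> g y \<longleftrightarrow> x \<le> y"
  by (simp add: linorder_not_less[symmetric])

lemma act_eq_iff [simp]: "g \<in> carrier G \<Longrightarrow> \<phi> g x = \<phi> g y \<longleftrightarrow> x = y"
  by (simp add: order_eq_iff)

lemma act_inv_less_iff:
  "g \<in> carrier G \<Longrightarrow> \<phi> (inv g) x < y \<longleftrightarrow> x < \<phi> g y"
  "g \<in> carrier G \<Longrightarrow> x < \<phi> (inv g) y \<longleftrightarrow> \<phi> g x < y"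
  by (metis act_inv(2) act_less_iff)+

lemma act_inv_eq_iff: "g \<in> carrier G \<Longrightarrow> \<phi> (inv g) x = x \<longleftrightarrow> \<phi> g x = x"
  by (metis act_inv)

lemma act_continuous: "g \<in> carrier G \<Longrightarrow> continuous_on UNIV (\<phi> g)"
  using action by (auto simp: order_pres_action_def homeomorphism_def)

lemma act_mono: "g \<in> carrier G \<Longrightarrow> mono (\<phi> g)"
  by (simp add: monoI)

lemma act_pow: "g \<in> carrier G \<Longrightarrow> \<phi> (g [^] (n::nat)) x = (\<phi> g ^^ n) x"
  by (induction n arbitrary: x) (auto simp: funpow_swap1)

definition has_fix :: "'a \<Rightarrow> bool" where
  "has_fix g \<longleftrightarrow> (\<exists>x. \<phi> g x = x)"

definition lt :: "'a \<Rightarrow> 'a \<Rightarrow> bool" where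
  "lt g h \<longleftrightarrow> (\<forall>x. \<phi> g x < \<phi> h x)"

text \<open>Fixed points survive inversion and conjugation, so for a subgroup \<open>H\<close> this
  makes the elements with a fixed point a normal subgroup of \<open>H\<close>, which becomes the
  kernel of the translation number.\<close>

definition coherent :: "'a set \<Rightarrow> bool" where
  "coherent H \<longleftrightarrow> (\<forall>f\<in>H. \<forall>g\<in>H. has_fix f \<longrightarrow> has_fix g \<longrightarrow> has_fix (f \<otimes> g))"

definition Fix :: "'a set \<Rightarrow> real set" where
  "Fix K = {x. \<forall>k\<in>K. \<phi> k x = x}"

definition invariant :: "'a set \<Rightarrow> real set \<Rightarrow> bool" where
  "invariant H E \<longleftrightarrow> (\<forall>h\<in>H. \<forall>x\<in>E. \<phi> h x \<in> E)"

text \<open>Intermediate value theorem for the displacement \<open>\<phi> g x - x\<close>.\<close>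

lemma fix_or_lt:
  assumes g: "g \<in> carrier G"
  shows "has_fix g \<or> lt \<one> g \<or> lt g \<one>"
proof (rule ccontr)
  assume no: "\<not> ?thesis"
  let ?d = "\<lambda>x. \<phi> g x - x"
  have "continuous_on UNIV ?d"
    by (intro continuous_intros act_continuous[OF g])
  then have conn: "connected (range ?d)"
    by (rule connected_continuous_image) simp
  obtain x y where "\<phi> g x \<le> x" "y \<le> \<phi> g y"
    using no by (auto simp: lt_def not_less)
  then have "?d x \<le> 0" "0 \<le> ?d y" by simp_all
  then have "0 \<in> range ?d"
    by (rule connectedD_interval[OF conn rangeI rangeI])
  then show False
    using no by (auto simp: has_fix_def)
qed

lemma has_fix_not_lt: "has_fix g \<Longrightarrow> \<not> lt \<one> g \<and> \<not> lt g \<one>"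
  by (metis act_one has_fix_def lt_def less_irrefl)

lemma has_fix_inv [simp]: "g \<in> carrier G \<Longrightarrow> has_fix (inv g) \<longleftrightarrow> has_fix g"
  by (simp add: has_fix_def act_inv_eq_iff)

lemma has_fix_conj [simp]:
  assumes "g \<in> carrier G" "h \<in> carrier G"
  shows "has_fix (g \<otimes> h \<otimes> inv g) \<longleftrightarrow> has_fix h"
proof
  assume "has_fix h"
  then obtain x where "\<phi> h x = x" by (auto simp: has_fix_def)
  then have "\<phi> (g \<otimes> h \<otimes> inv g) (\<phi> g x) = \<phi> g x" using assms by simp
  then show "has_fix (g \<otimes> h \<otimes> inv g)" by (auto simp: has_fix_def)
next
  assume "has_fix (g \<otimes> h \<otimes> inv g)"
  then obtain x where "\<phi> g (\<phi> h (\<phi> (inv g) x)) = x" using assms by (auto simp: has_fix_def)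
  then have "\<phi> h (\<phi> (inv g) x) = \<phi> (inv g) x" using assms by (metis act_inv(1))
  then show "has_fix h" by (auto simp: has_fix_def)
qed

lemma lt_one_conj:
  assumes "g \<in> carrier G" "h \<in> carrier G"
  shows "lt \<one> (g \<otimes> h \<otimes> inv g) \<longleftrightarrow> lt \<one> h"
proof -
  have "lt \<one> (g \<otimes> h \<otimes> inv g) \<longleftrightarrow> (\<forall>x. \<phi> (inv g) x < \<phi> h (\<phi> (inv g) x))"
    using assms by (simp add: lt_def act_inv_less_iff)
  also have "\<dots> \<longleftrightarrow> lt \<one> h"
    using assms by (metis act_inv(1) act_one lt_def)
  finally show ?thesis .
qed

lemma lt_iff_lt_one:
  assumes "g \<in> carrier G" "h \<in> carrier G"
  shows "lt g h \<longleftrightarrow> lt \<one> (inv g \<otimes> h)"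
  using assms by (simp add: lt_def act_inv_less_iff)

lemma lt_one_inv: "g \<in> carrier G \<Longrightarrow> lt \<one> (inv g) \<longleftrightarrow> lt g \<one>"
  by (simp add: lt_def act_inv_less_iff)

text \<open>From any point of \<open>E\<close>, either \<open>g\<close> or its inverse does not lead
  away from a given fixed point \<open>p\<close>. Its iterates are trapped by \<open>p\<close> and
  converge to a fixed point, which lies in \<open>E\<close> because \<open>E\<close> is
  closed.\<close>

lemma fix_in_invariant_set:
  assumes g: "g \<in> carrier G" and "has_fix g" and E: "closed E" "E \<noteq> {}" "invariant {g, inv g} E"
  shows "\<exists>x\<in>E. \<phi> g x = x"
proof -
  obtain p where p: "\<phi> g p = p" using assms(2) by (auto simp: has_fix_def)
  obtain e where e: "e \<in> E" using E by blast
  have *: "\<exists>x\<in>E. \<phi> f x = x" if f: "f \<in> carrier G" "\<phi> f p = p" "invariant {f} E"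
    and mv: "e \<le> p \<and> e \<le> \<phi> f e \<or> p \<le> e \<and> \<phi> f e \<le> e" for f
  proof -
    have inv: "\<And>x. x \<in> E \<Longrightarrow> \<phi> f x \<in> E" using f by (auto simp: invariant_def)
    have up: "(\<phi> f ^^ n) e \<le> p" if "e \<le> p" for n
      by (induction n) (use that f in \<open>auto, metis act_le_iff\<close>)
    have dn: "p \<le> (\<phi> f ^^ n) e" if "p \<le> e" for n
      by (induction n) (use that f in \<open>auto, metis act_le_iff\<close>)
    show ?thesis
      using mv
    proof
      assume e1: "e \<le> p \<and> e \<le> \<phi> f e"
      have "\<exists>c\<in>E. \<phi> f c = c \<and> c \<le> p \<and> (\<forall>n. (\<phi> f ^^ n) e \<le> c) \<and> (\<forall>y<c. \<exists>n. y < (\<phi> f ^^ n) e)"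
        using e1 e inv up by (intro iterate_limit_up act_mono act_continuous f E) auto
      then show ?thesis by blast
    next
      assume e1: "p \<le> e \<and> \<phi> f e \<le> e"
      have "\<exists>c\<in>E. \<phi> f c = c \<and> p \<le> c \<and> (\<forall>n. c \<le> (\<phi> f ^^ n) e) \<and> (\<forall>y>c. \<exists>n. (\<phi> f ^^ n) e < y)"
        using e1 e inv dn by (intro iterate_limit_down act_mono act_continuous f E) auto
      then show ?thesis by blast
    qed
  qed
  have "e \<le> \<phi> (inv g) e \<longleftrightarrow> \<phi> g e \<le> e"
    using g by (metis act_inv(2) act_le_iff)
  moreover have "\<phi> (inv g) e \<le> e \<longleftrightarrow> e \<le> \<phi> g e"
    using g by (metis act_inv(2) act_le_iff)
  moreover have "\<phi> (inv g) p = p" "invariant {g} E" "invariant {inv g} E"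
    using p g E(3) by (auto simp: act_inv_eq_iff invariant_def)
  moreover have "e \<le> p \<or> p \<le> e" "e \<le> \<phi> g e \<or> \<phi> g e \<le> e"
    by (rule linear)+
  ultimately have "(\<exists>x\<in>E. \<phi> g x = x) \<or> (\<exists>x\<in>E. \<phi> (inv g) x = x)"
    using *[of g] *[of "inv g"] p g by blast
  then show ?thesis
    using g by (simp add: act_inv_eq_iff)
qed

section \<open>Common fixed points and orbits\<close>

lemma closed_Fix: "K \<subseteq> carrier G \<Longrightarrow> closed (Fix K)"
proof -
  assume K: "K \<subseteq> carrier G"
  have "Fix K = (\<Inter>k\<in>K. {x. \<phi> k x = x})"
    by (auto simp: Fix_def)
  then show ?thesis
    using K act_continuous by (auto intro!: closed_INT closed_Collect_eq continuous_intros)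
qed

lemma invariant_Fix:
  assumes "K \<subseteq> carrier G" and conj: "\<And>g k. g \<in> carrier G \<Longrightarrow> k \<in> K \<Longrightarrow> g \<otimes> k \<otimes> inv g \<in> K"
  shows "invariant (carrier G) (Fix K)"
  unfolding invariant_def
proof (intro ballI)
  fix g x assume g: "g \<in> carrier G" and x: "x \<in> Fix K"
  show "\<phi> g x \<in> Fix K"
    unfolding Fix_def
  proof safe
    fix k assume k: "k \<in> K"
    with conj[of "inv g" k] g have "inv g \<otimes> k \<otimes> g \<in> K" by simp
    with x have "\<phi> (inv g \<otimes> k \<otimes> g) x = x" by (auto simp: Fix_def)
    moreover have "k \<in> carrier G" using k assms(1) by blast
    ultimately have "\<phi> (inv g) (\<phi> k (\<phi> g x)) = x" using g by simp
    then show "\<phi> k (\<phi> g x) = \<phi> g x" using g by (metis act_inv(2))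
  qed
qed

text \<open>The supremum of the orbit is moved up by no element of \<open>Z\<close>; applied to
  inverses, this shows that it is not moved down either.\<close>

lemma bounded_orbit_imp_Fix:
  assumes "subgroup Z G" and B: "\<And>z. z \<in> Z \<Longrightarrow> \<phi> z x \<le> B"
  shows "Fix Z \<noteq> {}"
proof -
  interpret Z: subgroup Z G by fact
  define s where "s = (SUP z\<in>Z. \<phi> z x)"
  have bdd: "bdd_above ((\<lambda>z. \<phi> z x) ` Z)" using B by (intro bdd_aboveI2)
  have le: "\<phi> z s \<le> s" if z: "z \<in> Z" for z
  proof (rule ccontr)
    assume "\<not> ?thesis"
    then have "\<phi> (inv z) s < s" using z by (simp add: act_inv_less_iff)
    then obtain y where y: "y \<in> Z" "\<phi> (inv z) s < \<phi> y x"
      using less_cSUP_iff[OF _ bdd] Z.one_closed unfolding s_def by blast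
    then have "s < \<phi> (z \<otimes> y) x" using z by (simp add: act_inv_less_iff)
    moreover have "\<phi> (z \<otimes> y) x \<le> s" unfolding s_def using z y by (intro cSUP_upper bdd) auto
    ultimately show False by simp
  qed
  have "\<phi> z s = s" if z: "z \<in> Z" for z
  proof (rule antisym)
    show "s \<le> \<phi> z s" using le[of "inv z"] z by (simp add: linorder_not_less[symmetric] act_inv_less_iff)
  qed (rule le[OF z])
  then show ?thesis by (auto simp: Fix_def)
qed

text \<open>A bounded orbit would converge to a fixed point of \<open>g\<close>.\<close>

lemma lt_one_pow_unbounded:
  assumes g: "g \<in> carrier G" "lt \<one> g"
  shows "\<exists>n::nat. y < \<phi> (g [^] n) x"
proof (rule ccontr)
  assume "\<not> ?thesis"
  then have "(\<phi> g ^^ n) x \<le> y" for n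
    using g by (auto simp: act_pow not_less)
  moreover have "x \<le> \<phi> g x" using g by (simp add: lt_def less_imp_le)
  ultimately have "\<exists>c\<in>UNIV. \<phi> g c = c"
    using iterate_limit_up[OF act_mono[OF g(1)] act_continuous[OF g(1)] closed_UNIV, of x y] by blast
  then show False using g(2) by (metis act_one less_irrefl lt_def)
qed

subsection \<open>Ping-pong\<close>

lemma act_pow_fixed: "g \<in> carrier G \<Longrightarrow> \<phi> g x = x \<Longrightarrow> \<phi> (g [^] (n::nat)) x = x"
  by (induction n) auto

text \<open>A point moved by \<open>g\<close> keeps moving in the same direction under further
  powers.\<close>

lemma act_pow_fixed_imp_fixed:
  assumes g: "g \<in> carrier G" and fixed: "\<phi> (g [^] Suc n) x = x"
  shows "\<phi> g x = x"
proof -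
  have "\<phi> (g [^] Suc n) x < x" if "\<phi> g x < x"
  proof (induction n)
    case (Suc n)
    have "\<phi> (g [^] Suc (Suc n)) x < \<phi> (g [^] Suc n) x"
      using that g by simp
    with Suc show ?case by simp
  qed (use that g in simp)
  moreover have "x < \<phi> (g [^] Suc n) x" if "x < \<phi> g x"
  proof (induction n)
    case (Suc n)
    have "\<phi> (g [^] Suc n) x < \<phi> (g [^] Suc (Suc n)) x"
      using that g by simp
    with Suc show ?case by simp
  qed (use that g in simp)
  ultimately show ?thesis
    using fixed by (metis less_irrefl linorder_neqE_linordered_idom)
qed

text \<open>Both maps send \<open>{u..<v}\<close> into itself, the image under \<open>f\<close>
  lying below the image under \<open>g\<close>. Words with different first letters are thereby
  separated; equal first letters are cancelled by injectivity.\<close>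

lemma ping_pong_words:
  assumes fg: "f \<in> carrier G" "g \<in> carrier G"
    and pp: "u < v" "u \<le> \<phi> f u" "\<phi> g v \<le> v" "\<phi> f v < \<phi> g u"
  shows "u \<le> \<phi> (word_eval G f g w) u \<and> \<phi> (word_eval G f g w) u < v"
    and "length w = length w' \<Longrightarrow> w \<noteq> w' \<Longrightarrow> \<phi> (word_eval G f g w) u \<noteq> \<phi> (word_eval G f g w') u"
proof -
  define I where "I = {u..<v}"
  have fI: "\<phi> f y \<in> I" and gI: "\<phi> g y \<in> I" and sep: "z \<in> I \<Longrightarrow> \<phi> f y < \<phi> g z"
    if "y \<in> I" for y z
  proof -
    have y: "u \<le> \<phi> f y" "\<phi> f y < \<phi> f v" "\<phi> g u \<le> \<phi> g y" "\<phi> g y < \<phi> g v"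
      "\<phi> f u < \<phi> f v" "\<phi> g u < \<phi> g v" "\<phi> f u \<le> \<phi> f y"
      using that fg pp(1,2) order_trans[of u "\<phi> f u" "\<phi> f y"] by (simp_all add: I_def)
    show "\<phi> f y \<in> I" "\<phi> g y \<in> I"
      using y pp unfolding I_def atLeastLessThan_iff by linarith+
    show "\<phi> f y < \<phi> g z" if "z \<in> I"
    proof -
      have "\<phi> g u \<le> \<phi> g z" using that fg by (simp add: I_def)
      with y pp(4) show ?thesis by linarith
    qed
  qed
  have range: "\<phi> (word_eval G f g w) u \<in> I" for w
    by (induction w) (use pp(1) fg fI gI in \<open>auto simp: I_def\<close>)
  then show "u \<le> \<phi> (word_eval G f g w) u \<and> \<phi> (word_eval G f g w) u < v"
    by (simp add: I_def)
  show "length w = length w' \<Longrightarrow> w \<noteq> w' \<Longrightarrow> \<phi> (word_eval G f g w) u \<noteq> \<phi> (word_eval G f g w') u"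
  proof (induction w w' rule: list_induct2)
    case (Cons b w b' w')
    let ?y = "\<phi> (word_eval G f g w) u" and ?z = "\<phi> (word_eval G f g w') u"
    have "\<phi> f ?y \<noteq> \<phi> g ?z" "\<phi> g ?y \<noteq> \<phi> f ?z"
      using sep[OF range range, of w w'] sep[OF range range, of w' w] by linarith+
    moreover have "?y \<noteq> ?z" if "b = b'"
      using Cons that by blast
    ultimately show ?case
      using fg by (cases b; cases b') simp_all
  qed simp
qed

text \<open>The discrepancy \<open>k\<close> of a coincidence fixes \<open>u\<close>, so two
  different words of equal length would agree at \<open>u\<close>, against
  \<open>ping_pong_words\<close>.\<close>

lemma no_ping_pong_on_Fix:
  assumes "subgroup H G" "K \<subseteq> carrier G" "word_coincident H K" and fg: "f \<in> H" "g \<in> H"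
    and u: "u \<in> Fix K" "u < v" "u \<le> \<phi> f u" "\<phi> g v \<le> v"
  shows "\<phi> g u \<le> \<phi> f v"
proof (rule ccontr)
  assume "\<not> ?thesis"
  then have less: "\<phi> f v < \<phi> g u" by simp
  have fgG: "f \<in> carrier G" "g \<in> carrier G"
    using fg subgroup.mem_carrier[OF assms(1)] by simp_all
  from assms(3) fg have "\<exists>w w' k. length w = length w' \<and> w \<noteq> w' \<and> k \<in> K \<and>
     word_eval G f g w = word_eval G f g w' \<otimes> k"
    by (simp only: word_coincident_def)
  then obtain w w' k where w: "length w = length w'" "w \<noteq> w'" "k \<in> K"
    "word_eval G f g w = word_eval G f g w' \<otimes> k"
    by (elim exE conjE)
  have "\<phi> (word_eval G f g w) u = \<phi> (word_eval G f g w') u"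
    using w(3,4) u(1) fgG assms(2) by (auto simp: Fix_def)
  then show False
    using ping_pong_words(2)[OF fgG u(2-4) less w(1,2)] by simp
qed

text \<open>Only the special ping-pong met in \<open>not_opposite_attractors\<close>: the endpoints
  are fixed, and \<open>f\<close> fixes no further point of \<open>E\<close> up to \<open>v\<close>.
  The latter condition lets \<open>coherent_extension\<close> confine the interval to one
  fundamental domain of \<open>e\<close>.\<close>

definition ping_pong_free :: "'a set \<Rightarrow> real set \<Rightarrow> bool" where
  "ping_pong_free H E \<longleftrightarrow> (\<forall>f\<in>H. \<forall>g\<in>H. \<forall>u\<in>E. \<forall>v\<in>E. u < v \<longrightarrow> \<phi> f u = u \<longrightarrow> \<phi> g v = v \<longrightarrow>
     (\<forall>x\<in>E. u < x \<and> x \<le> v \<longrightarrow> \<phi> f x \<noteq> x) \<longrightarrow> \<phi> g u \<le> \<phi> f v)"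

text \<open>Powers of \<open>c\<close> bring \<open>v\<close> down to \<open>u\<close>, and powers
  of \<open>d\<close> bring \<open>u\<close> up to \<open>v\<close>. High powers are therefore
  separated by an intermediate point \<open>y\<close>, and form a ping-pong pair.\<close>

lemma not_opposite_attractors:
  assumes "subgroup H G" "closed E" "invariant H E" "ping_pong_free H E"
    and cd: "c \<in> H" "d \<in> H" and uv: "u \<in> E" "v \<in> E" "u < v" "\<phi> c u = u" "\<phi> d v = v"
    and mv: "\<phi> c v < v" "u < \<phi> d u"
    and noc: "\<And>x. x \<in> E \<Longrightarrow> u < x \<Longrightarrow> x \<le> v \<Longrightarrow> \<phi> c x \<noteq> x"
    and nod: "\<And>x. x \<in> E \<Longrightarrow> u \<le> x \<Longrightarrow> x < v \<Longrightarrow> \<phi> d x \<noteq> x"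
  shows False
proof -
  interpret H: subgroup H G by fact
  have cdG [simp]: "c \<in> carrier G" "d \<in> carrier G" using cd by auto
  have inv: "\<And>x. x \<in> E \<Longrightarrow> \<phi> c x \<in> E" "\<And>x. x \<in> E \<Longrightarrow> \<phi> d x \<in> E"
    using cd assms(3) by (auto simp: invariant_def)
  have dn: "u \<le> (\<phi> c ^^ n) v" for n
  proof -
    have "\<phi> (c [^] n) u \<le> \<phi> (c [^] n) v" using uv by simp
    then show ?thesis using uv by (simp only: act_pow_fixed cdG) (simp add: act_pow)
  qed
  have up: "(\<phi> d ^^ n) u \<le> v" for n
  proof -
    have "\<phi> (d [^] n) u \<le> \<phi> (d [^] n) v" using uv by simp
    then show ?thesis using uv by (simp only: act_pow_fixed cdG) (simp add: act_pow)
  qed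
  have "\<exists>p\<in>E. \<phi> c p = p \<and> u \<le> p \<and> (\<forall>n. p \<le> (\<phi> c ^^ n) v) \<and> (\<forall>y>p. \<exists>n. (\<phi> c ^^ n) v < y)"
    using uv mv dn inv assms(2) by (intro iterate_limit_down act_mono act_continuous) auto
  then obtain p where p: "p \<in> E" "\<phi> c p = p" "u \<le> p" "p \<le> v" "\<And>y. p < y \<Longrightarrow> \<exists>n. (\<phi> c ^^ n) v < y"
    by (metis funpow_0)
  \<comment> \<open>The limit of the orbit is a fixed point of \<open>c\<close> in \<open>E\<close>
    between \<open>u\<close> and \<open>v\<close>, and \<open>u\<close> is the only one.\<close>
  have "p = u" using noc[OF p(1)] p by force
  have "\<exists>q\<in>E. \<phi> d q = q \<and> q \<le> v \<and> (\<forall>n. (\<phi> d ^^ n) u \<le> q) \<and> (\<forall>y<q. \<exists>n. y < (\<phi> d ^^ n) u)"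
    using uv mv up inv assms(2) by (intro iterate_limit_up act_mono act_continuous) auto
  then obtain q where q: "q \<in> E" "\<phi> d q = q" "q \<le> v" "u \<le> q" "\<And>y. y < q \<Longrightarrow> \<exists>n. y < (\<phi> d ^^ n) u"
    by (metis funpow_0)
  have "q = v" using nod[OF q(1)] q by force
  obtain y where y: "u < y" "y < v" using dense uv by blast
  obtain m where m: "(\<phi> c ^^ m) v < y" using p(5) y \<open>p = u\<close> by blast
  obtain n where n: "y < (\<phi> d ^^ n) u" using q(5) y \<open>q = v\<close> by blast
  \<comment> \<open>The exponent is positive because \<open>v\<close> is not below \<open>y\<close>;
    the zeroth power would fix every point.\<close>
  obtain m' where m': "m = Suc m'" using m y by (cases m) auto
  have "\<phi> (d [^] n) u \<le> \<phi> (c [^] m) v"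
  proof -
    have "c [^] m \<in> H" "d [^] n \<in> H"
      using cd subgroup_nat_pow_closed[OF H.subgroup_axioms] by blast+
    moreover have "\<phi> (c [^] m) u = u" "\<phi> (d [^] n) v = v"
      using uv by (simp_all add: act_pow_fixed)
    moreover have "\<phi> (c [^] m) x \<noteq> x" if "x \<in> E" "u < x" "x \<le> v" for x
      using noc[OF that] act_pow_fixed_imp_fixed[OF cdG(1)] unfolding m' by blast
    ultimately show ?thesis
      using assms(4) uv unfolding ping_pong_free_def by blast
  qed
  with m n show False by (simp add: act_pow)
qed

text \<open>If \<open>f \<otimes> g\<close> had no fixed point, \<open>inv f\<close> and
  \<open>g\<close> would be comparable pointwise. Of two comparable elements \<open>a\<close> below
  \<open>b\<close> with fixed points, \<open>a\<close> moves the fixed points of \<open>b\<close>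
  down and \<open>b\<close> moves those of \<open>a\<close> up; neighbouring fixed points then give
  opposite attractors.\<close>

lemma coherent_if_ping_pong_free:
  assumes "subgroup H G" "closed E" "E \<noteq> {}" "invariant H E" "ping_pong_free H E"
  shows "coherent H"
proof -
  interpret H: subgroup H G by fact
  have HG: "h \<in> carrier G" if "h \<in> H" for h using that by simp
  have core: False if ab: "a \<in> H" "b \<in> H" and "has_fix a" "has_fix b" and lt: "lt a b" for a b
  proof -
    have [simp]: "a \<in> carrier G" "b \<in> carrier G" using ab by auto
    note attr = not_opposite_attractors[OF assms(1,2,4,5)]
    define P where "P = {x \<in> E. \<phi> a x = x}"
    define Q where "Q = {x \<in> E. \<phi> b x = x}"
    have fixed_closed: "closed {x \<in> E. \<phi> h x = x}" if "h \<in> carrier G" for h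
    proof -
      have "{x \<in> E. \<phi> h x = x} = E \<inter> {x. \<phi> h x = x}" by auto
      then show ?thesis
        using assms(2) act_continuous[OF that] by (auto intro!: closed_Int closed_Collect_eq continuous_intros)
    qed
    have cl: "closed P" "closed Q" by (auto simp: P_def Q_def fixed_closed)
    have "P \<noteq> {}"
      using fix_in_invariant_set[of a E] assms ab that unfolding P_def invariant_def by auto
    have "Q \<noteq> {}"
      using fix_in_invariant_set[of b E] assms ab that unfolding Q_def invariant_def by auto
    have ltP: "p < \<phi> b p" if "p \<in> P" for p
      using lt that unfolding lt_def P_def by (metis (mono_tags, lifting) mem_Collect_eq)
    have ltQ: "\<phi> a q < q" if "q \<in> Q" for q
      using lt that unfolding lt_def Q_def by (metis (mono_tags, lifting) mem_Collect_eq)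
    show False
    proof (cases "\<exists>p\<in>P. \<exists>q\<in>Q. p < q")
      case True
      then obtain p0 q0 where pq0: "p0 \<in> P" "q0 \<in> Q" "p0 < q0" by blast
      \<comment> \<open>The last fixed point of \<open>a\<close> in \<open>E\<close> up to
        \<open>q0\<close>, and then the first one of \<open>b\<close> from \<open>p\<close> on: no
        others lie between them.\<close>
      define p where "p = Sup (P \<inter> {..q0})"
      have p: "p \<in> P \<inter> {..q0}" unfolding p_def
        using pq0 cl by (intro closed_contains_Sup) (auto intro!: bdd_aboveI[of _ q0])
      have pmax: "x \<le> p" if "x \<in> P" "x \<le> q0" for x
        unfolding p_def using that by (intro cSup_upper) (auto intro!: bdd_aboveI[of _ q0])
      define q where "q = Inf (Q \<inter> {p..})"
      have q: "q \<in> Q \<inter> {p..}" unfolding q_def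
        using pq0 p cl by (intro closed_contains_Inf) (auto intro!: bdd_belowI[of _ p])
      have qmin: "q \<le> x" if "x \<in> Q" "p \<le> x" for x
        unfolding q_def using that by (intro cInf_lower) (auto intro!: bdd_belowI[of _ p])
      have "q \<le> q0" using qmin pq0 p by auto
      have "p \<noteq> q" using ltP[of p] p q by (auto simp: Q_def)
      then have "p < q" using q by simp
      show False
      proof (rule attr[of a b p q])
        show "\<phi> a x \<noteq> x" if "x \<in> E" "p < x" "x \<le> q" for x
          using pmax[of x] that \<open>q \<le> q0\<close> by (auto simp: P_def)
        show "\<phi> b x \<noteq> x" if "x \<in> E" "p \<le> x" "x < q" for x
          using qmin[of x] that by (auto simp: Q_def)
      qed (use p q \<open>p < q\<close> ab ltP ltQ in \<open>auto simp: P_def Q_def\<close>)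
    next
      case False
      then have QP: "q \<le> p" if "p \<in> P" "q \<in> Q" for p q using that by force
      obtain p0 q0 where pq0: "p0 \<in> P" "q0 \<in> Q" using \<open>P \<noteq> {}\<close> \<open>Q \<noteq> {}\<close> by blast
      \<comment> \<open>All fixed points of \<open>b\<close> in \<open>E\<close> now precede those
        of \<open>a\<close>. The gap from \<open>Sup Q\<close> to \<open>Inf P\<close> is used, with
        inverses because \<open>a\<close> and \<open>b\<close> push its ends outwards.\<close>
      define p where "p = Inf P"
      have bP: "bdd_below P" using QP pq0 by (auto intro!: bdd_belowI[of _ q0])
      have bQ: "bdd_above Q" using QP pq0 by (auto intro!: bdd_aboveI[of _ p0])
      have p: "p \<in> P" unfolding p_def
        using \<open>P \<noteq> {}\<close> cl bP by (intro closed_contains_Inf)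
      have pmin: "p \<le> x" if "x \<in> P" for x
        unfolding p_def using that bP by (intro cInf_lower)
      define q where "q = Sup Q"
      have q: "q \<in> Q" unfolding q_def
        using \<open>Q \<noteq> {}\<close> cl bQ by (intro closed_contains_Sup)
      have qmax: "x \<le> q" if "x \<in> Q" for x
        unfolding q_def using that bQ by (intro cSup_upper)
      have "p \<noteq> q" using ltP[of p] p q by (auto simp: Q_def)
      then have "q < p" using QP[OF p q] by simp
      show False
      proof (rule attr[of "inv b" "inv a" q p])
        show "\<phi> (inv b) x \<noteq> x" if "x \<in> E" "q < x" "x \<le> p" for x
          using qmax[of x] that by (auto simp: Q_def act_inv_eq_iff)
        show "\<phi> (inv a) x \<noteq> x" if "x \<in> E" "q \<le> x" "x < p" for x
          using pmin[of x] that by (auto simp: P_def act_inv_eq_iff)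
      qed (use p q \<open>q < p\<close> ab ltP ltQ in \<open>auto simp: P_def Q_def act_inv_less_iff act_inv_eq_iff\<close>)
    qed
  qed
  show ?thesis
    unfolding coherent_def
  proof (intro ballI impI, rule ccontr)
    fix f g assume fg: "f \<in> H" "g \<in> H" and fixed: "has_fix f" "has_fix g" and "\<not> has_fix (f \<otimes> g)"
    then consider "lt \<one> (f \<otimes> g)" | "lt (f \<otimes> g) \<one>" using fix_or_lt[of "f \<otimes> g"] by auto
    then show False
    proof cases
      case 1
      then have "lt (inv f) g" using fg lt_iff_lt_one[of "inv f" g] by simp
      then show False using core[of "inv f" g] fg fixed by simp
    next
      case 2
      have "\<phi> g x < \<phi> (inv f) x" for x
        using 2 fg by (simp add: lt_def act_inv_less_iff)
      then have "lt g (inv f)" by (simp add: lt_def)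
      then show False using core[of g "inv f"] fg fixed by simp
    qed
  qed
qed

text \<open>
  If \<open>h\<close> had a fixed point above \<open>x\<close>, let \<open>b\<close> be the limit of \<open>h\<^sup>n x\<close>. Powers of \<open>h\<close> contract
  \<open>[T x, b]\<close> towards \<open>b\<close>, whereas \<open>h\<^sup>2 T h\<^sup>-\<^sup>1 T\<^sup>-\<^sup>1\<close> maps this interval into itself and moves \<open>b\<close>
  down: this is ping-pong. A fixed point below \<open>x\<close> is excluded by the mirror image of the argument.
\<close>

lemma fixed_point_free_if_displacement:
  assumes "A \<lhd> G" "closed E" "invariant (carrier G) E"
    and T: "T \<in> carrier G" "lt \<one> T" and h: "h \<in> A" and x: "x \<in> E" "\<phi> T x < \<phi> h x"
    and npp: "\<And>f g u v. \<lbrakk>f \<in> A; g \<in> A; u \<in> E; v \<in> E; u < v; u \<le> \<phi> f u; \<phi> g v \<le> v\<rbrakk> \<Longrightarrow> \<phi> g u \<le> \<phi> f v"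
  shows "\<not> has_fix h"
proof
  assume "has_fix h"
  then obtain p where p: "\<phi> h p = p" by (auto simp: has_fix_def)
  interpret A: normal A G by fact
  have hG [simp]: "h \<in> carrier G" using h by simp
  note [simp] = T(1)
  have E: "\<phi> g y \<in> E" if "g \<in> carrier G" "y \<in> E" for g y
    using that assms(3) by (auto simp: invariant_def)
  have Tx: "y < \<phi> T y" for y using T(2) by (simp add: lt_def)
  have Ty: "\<phi> (inv T) y < y" for y using Tx[of y] by (simp add: act_inv_less_iff)
  have "x < \<phi> h x" using Tx[of x] x by linarith
  then have "x \<noteq> p" using p by auto
  then consider "x < p" | "p < x" by linarith
  then show False
  proof cases
    case 1
    have "(\<phi> h ^^ n) x \<le> p" for n
    proof -
      have "\<phi> (h [^] n) x \<le> \<phi> (h [^] n) p" using 1 by simp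
      also have "\<dots> = p" using p by (rule act_pow_fixed[OF hG])
      finally show ?thesis by (simp add: act_pow)
    qed
    then have "\<exists>b\<in>E. \<phi> h b = b \<and> b \<le> p \<and> (\<forall>n. (\<phi> h ^^ n) x \<le> b) \<and> (\<forall>y<b. \<exists>n. y < (\<phi> h ^^ n) x)"
      using x \<open>x < \<phi> h x\<close> assms(2) E by (intro iterate_limit_up act_mono act_continuous) auto
    then obtain b where b: "b \<in> E" "\<phi> h b = b" "\<And>n. (\<phi> h ^^ n) x \<le> b" "\<And>y. y < b \<Longrightarrow> \<exists>n. y < (\<phi> h ^^ n) x"
      by blast
    have "\<phi> h x \<le> b" using b(3)[of 1] by simp
    then have Tb: "\<phi> T x < b" using x by linarith
    let ?y = "\<phi> (inv T) b"
    have y: "x < ?y" "?y < b" using Tb Ty by (simp_all add: act_inv_less_iff)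
    \<comment> \<open>Otherwise the orbit of \<open>x\<close>, which starts below \<open>?y\<close>,
      could not pass \<open>?y\<close> on its way to \<open>b\<close>.\<close>
    have "?y < \<phi> h ?y"
    proof (rule ccontr)
      assume "\<not> ?thesis"
      then have hy: "\<phi> h ?y \<le> ?y" by simp
      have "(\<phi> h ^^ n) x \<le> ?y" for n
      proof (induction n)
        case (Suc n)
        then have "\<phi> h ((\<phi> h ^^ n) x) \<le> \<phi> h ?y" by simp
        from this hy have "\<phi> h ((\<phi> h ^^ n) x) \<le> ?y" by (rule order_trans)
        then show ?case by simp
      qed (use y in simp)
      with b(4)[OF y(2)] show False by (meson not_less)
    qed
    then have "\<phi> (inv h) ?y < ?y" by (simp only: act_inv_less_iff(1)[OF hG])
    then have fb: "\<phi> T (\<phi> (inv h) ?y) < b"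
      using act_less_iff[OF T(1), of "\<phi> (inv h) ?y" ?y] by simp
    \<comment> \<open>Bracketed as a product of \<open>h\<close>, \<open>h\<close> and a conjugate
      of \<open>inv h\<close>, which lies in the normal subgroup \<open>A\<close> although
      \<open>T\<close> need not.\<close>
    define f where "f = h \<otimes> h \<otimes> (T \<otimes> inv h \<otimes> inv T)"
    have "f \<in> A" using h T unfolding f_def by (intro A.m_closed A.inv_op_closed2) auto
    have phi_f: "\<phi> f z = \<phi> h (\<phi> h (\<phi> T (\<phi> (inv h) (\<phi> (inv T) z))))" for z
      by (simp add: f_def)
    have "\<phi> f b < \<phi> h (\<phi> h b)" unfolding phi_f using fb by (simp del: b(2))
    then have "\<phi> f b < b" using b(2) by simp
    then obtain n where n: "\<phi> f b < (\<phi> h ^^ n) x" using b(4) by blast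
    have "\<phi> h x < \<phi> h (\<phi> h (\<phi> T (\<phi> (inv h) x)))"
      using Tx[of "\<phi> (inv h) x"] by (simp add: act_inv_less_iff(1)[OF hG])
    from less_trans[OF x(2) this] have "\<phi> T x \<le> \<phi> f (\<phi> T x)"
      unfolding phi_f by simp
    moreover have hn: "h [^] n \<in> A" using h by (rule subgroup_nat_pow_closed[OF A.subgroup_axioms])
    moreover have "\<phi> (h [^] n) b \<le> b" using b(2) by (simp add: act_pow_fixed)
    ultimately have "\<phi> (h [^] n) (\<phi> T x) \<le> \<phi> f b"
      by (intro npp[OF \<open>f \<in> A\<close> hn E[OF T(1) x(1)] b(1) Tb])
    moreover have "\<phi> (h [^] n) x < \<phi> (h [^] n) (\<phi> T x)" using Tx by simp
    ultimately show False using n by (simp add: act_pow)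
  next
    case 2
    \<comment> \<open>In the mirror image, \<open>\<phi> h x\<close>, \<open>inv h\<close> and
      \<open>inv T\<close> take the places of \<open>x\<close>, \<open>h\<close> and
      \<open>T\<close>.\<close>
    let ?y = "\<phi> h x"
    have "p \<le> (\<phi> (inv h) ^^ n) ?y" for n
    proof -
      have "\<phi> (inv h [^] n) p \<le> \<phi> (inv h [^] n) ?y" using 2 \<open>x < ?y\<close> by simp
      moreover have "\<phi> (inv h [^] n) p = p"
        by (rule act_pow_fixed) (simp_all add: p act_inv_eq_iff)
      ultimately show ?thesis by (simp add: act_pow)
    qed
    then have "\<exists>a\<in>E. \<phi> (inv h) a = a \<and> p \<le> a \<and> (\<forall>n. a \<le> (\<phi> (inv h) ^^ n) ?y) \<and> (\<forall>z>a. \<exists>n. (\<phi> (inv h) ^^ n) ?y < z)"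
      using x \<open>x < \<phi> h x\<close> assms(2) E by (intro iterate_limit_down act_mono act_continuous) auto
    then obtain a where a: "a \<in> E" "\<phi> (inv h) a = a" "\<And>n. a \<le> (\<phi> (inv h) ^^ n) ?y"
      "\<And>z. a < z \<Longrightarrow> \<exists>n. (\<phi> (inv h) ^^ n) ?y < z"
      by blast
    let ?v = "\<phi> (inv T) ?y"
    have "x < ?v" using x by (simp add: act_inv_less_iff)
    moreover have "a \<le> x" using a(3)[of 1] by simp
    ultimately have av: "a < ?v" by linarith
    let ?z = "\<phi> T a"
    have z: "a < ?z" "?z < ?y" using Tx av by (simp_all add: act_inv_less_iff)
    have "\<phi> (inv h) ?z < ?z"
    proof (rule ccontr)
      assume "\<not> ?thesis"
      then have hz: "?z \<le> \<phi> (inv h) ?z" by simp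
      have "?z \<le> (\<phi> (inv h) ^^ n) ?y" for n
      proof (induction n)
        case (Suc n)
        then have "\<phi> (inv h) ?z \<le> \<phi> (inv h) ((\<phi> (inv h) ^^ n) ?y)" by simp
        with hz have "?z \<le> \<phi> (inv h) ((\<phi> (inv h) ^^ n) ?y)" by (rule order_trans)
        then show ?case by simp
      qed (use z in simp)
      with a(4)[OF z(1)] show False by (meson not_less)
    qed
    then have "?z < \<phi> h ?z" by (simp only: act_inv_less_iff(1)[OF hG])
    then have ga: "a < \<phi> (inv T) (\<phi> h ?z)"
      by (simp add: act_inv_less_iff)
    define g where "g = inv h \<otimes> inv h \<otimes> (inv T \<otimes> h \<otimes> T)"
    have "inv T \<otimes> h \<otimes> inv (inv T) \<in> A" using h T by (intro A.inv_op_closed2) auto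
    then have "inv T \<otimes> h \<otimes> T \<in> A" by simp
    from A.m_closed[OF A.m_closed[OF A.m_inv_closed[OF h] A.m_inv_closed[OF h]] this]
    have "g \<in> A" unfolding g_def .
    have phi_g: "\<phi> g z = \<phi> (inv h) (\<phi> (inv h) (\<phi> (inv T) (\<phi> h (\<phi> T z))))" for z
      by (simp add: g_def)
    have "\<phi> (inv h) (\<phi> (inv h) a) < \<phi> g a" unfolding phi_g using ga by (simp del: a(2))
    then have "a < \<phi> g a" using a(2) by simp
    then obtain n where n: "(\<phi> (inv h) ^^ n) ?y < \<phi> g a" using a(4) by blast
    have "\<phi> (inv h) (\<phi> (inv T) (\<phi> h ?y)) < ?y"
      using Ty[of "\<phi> h ?y"] by (simp only: act_inv_less_iff(1)[OF hG])
    then have "\<phi> (inv h) (\<phi> (inv h) (\<phi> (inv T) (\<phi> h ?y))) < \<phi> (inv h) ?y"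
      by (simp only: act_less_iff inv_closed hG)
    then have "\<phi> g ?v \<le> ?v"
      unfolding phi_g using \<open>x < ?v\<close> by simp
    moreover have hn: "inv h [^] n \<in> A" using h by (intro subgroup_nat_pow_closed[OF A.subgroup_axioms]) simp
    moreover have "a \<le> \<phi> (inv h [^] n) a" using a(2) by (simp add: act_pow_fixed)
    ultimately have "\<phi> g a \<le> \<phi> (inv h [^] n) ?v"
      by (intro npp[OF hn \<open>g \<in> A\<close> a(1) E[OF inv_closed[OF T(1)] E[OF hG x(1)]] av])
    moreover have "\<phi> (inv h [^] n) ?v < \<phi> (inv h [^] n) ?y" using Ty by simp
    ultimately show False using n by (simp add: act_pow)
  qed
qed

text \<open>Coherence enters through the transitivity of \<open>\<not> lt\<close>; the Archimedean
  property holds because powers of a fixed-point-free element have unbounded orbits.\<close>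

lemma coherent_archimedean:
  assumes "subgroup H G" "coherent H"
  shows "archimedean_ordered_group (G\<lparr>carrier := H\<rparr>) lt"
proof -
  interpret H: subgroup H G by fact
  interpret HG: group "G\<lparr>carrier := H\<rparr>" by (rule H.subgroup_is_group) (rule group_axioms)
  have HG: "h \<in> carrier G" if "h \<in> H" for h using that by simp
  have not_lt: "\<not> lt g h" if "g \<in> H" "h \<in> H" "\<phi> h x \<le> \<phi> g x" for g h x
    using that by (auto simp: lt_def not_less)
  have not_lt_iff: "\<not> lt g h \<longleftrightarrow> has_fix (inv h \<otimes> g) \<or> lt \<one> (inv h \<otimes> g)" if "g \<in> H" "h \<in> H" for g h
  proof -
    have "inv (inv g \<otimes> h) = inv h \<otimes> g" using that by (simp add: inv_mult_group)
    then have "lt g h \<longleftrightarrow> lt (inv h \<otimes> g) \<one>"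
      using lt_iff_lt_one[of g h] lt_one_inv[of "inv h \<otimes> g"] that by (metis HG H.m_closed H.m_inv_closed inv_inv)
    then show ?thesis
      using fix_or_lt[of "inv h \<otimes> g"] has_fix_not_lt[of "inv h \<otimes> g"] that
      by (metis (no_types, lifting) HG H.m_closed H.m_inv_closed act_one lt_def order.asym)
  qed
  have neg_trans: "\<not> lt x z" if xyz: "x \<in> H" "y \<in> H" "z \<in> H" and xy: "\<not> lt x y" and yz: "\<not> lt y z" for x y z
  proof
    assume "lt x z"
    \<comment> \<open>Each of \<open>p\<close> and \<open>q\<close> has a fixed point or moves every
      point up, whereas \<open>q \<otimes> p\<close> moves every point down. Coherence settles two
      fixed points; in the mixed cases the contradiction appears at the fixed point.\<close>
    define p where "p = inv y \<otimes> x"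
    define q where "q = inv z \<otimes> y"
    have pq: "p \<in> H" "q \<in> H" using xyz by (auto simp: p_def q_def)
    have "y \<otimes> (inv y \<otimes> x) = x" using xyz by (simp add: m_assoc[symmetric])
    then have "q \<otimes> p = inv z \<otimes> x" using xyz by (simp add: p_def q_def m_assoc)
    then have less: "\<phi> q (\<phi> p s) < s" for s
    proof -
      have "\<phi> q (\<phi> p s) = \<phi> (inv z) (\<phi> x s)"
        using \<open>q \<otimes> p = inv z \<otimes> x\<close> xyz pq act_mult[of q p s] by simp
      also have "\<dots> < s"
        using \<open>lt x z\<close> xyz by (simp add: lt_def act_inv_less_iff)
      finally show ?thesis .
    qed
    have "has_fix p \<or> lt \<one> p" "has_fix q \<or> lt \<one> q"
      using xy yz xyz not_lt_iff by (auto simp: p_def q_def)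
    then consider "has_fix p" "has_fix q" | "has_fix p" "lt \<one> q" | "lt \<one> p" "has_fix q" | "lt \<one> p" "lt \<one> q"
      by blast
    then show False
    proof cases
      case 1
      then have "has_fix (q \<otimes> p)" using assms(2) pq by (auto simp: coherent_def)
      then obtain s where "\<phi> q (\<phi> p s) = s" using pq by (auto simp: has_fix_def)
      with less[of s] show False by simp
    next
      case 2
      then obtain s where "\<phi> p s = s" by (auto simp: has_fix_def)
      with less[of s] 2(2) show False by (auto simp: lt_def dest: spec[of _ s])
    next
      case 3
      then obtain s where s: "\<phi> q s = s" by (auto simp: has_fix_def)
      have "s < \<phi> (inv p) s" using less[of "\<phi> (inv p) s"] s pq by simp
      moreover have "\<phi> (inv p) s < s" using 3(1) pq by (simp add: lt_def act_inv_less_iff)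
      ultimately show False by simp
    next
      case 4
      then have "s < \<phi> p s" "\<phi> p s < \<phi> q (\<phi> p s)" for s by (auto simp: lt_def)
      with less show False by (meson less_trans less_irrefl)
    qed
  qed
  show ?thesis
  proof (unfold_locales, simp_all)
    show "\<not> lt x x" for x by (simp add: lt_def)
    show "lt x z" if "lt x y" "lt y z" for x y z using that unfolding lt_def by (meson less_trans)
    show "\<not> lt x z" if "x \<in> H" "y \<in> H" "z \<in> H" "\<not> lt x y" "\<not> lt y z" for x y z
      using neg_trans that by blast
    show "lt (z \<otimes> x) (z \<otimes> y)" if "x \<in> H" "y \<in> H" "z \<in> H" "lt x y" for x y z
      using that by (simp add: lt_def)
    show "lt (x \<otimes> z) (y \<otimes> z)" if "x \<in> H" "y \<in> H" "z \<in> H" "lt x y" for x y z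
      using that by (simp add: lt_def)
    show "\<exists>n::nat. lt y (x [^]\<^bsub>G\<lparr>carrier := H\<rparr>\<^esub> n)" if xy: "x \<in> H" "y \<in> H" "lt \<one> x" for x y
    proof -
      obtain n :: nat where "\<phi> y 0 < \<phi> (x [^] n) 0"
        using lt_one_pow_unbounded[OF HG] xy by blast
      \<comment> \<open>A comparison at the single point \<open>0\<close> gives only this; one more
        factor \<open>x\<close> makes it strict by transitivity of \<open>\<not> lt\<close>.\<close>
      then have "\<not> lt (x [^] n) y"
        by (auto simp: lt_def not_less intro: less_imp_le)
      moreover have "lt (x [^] n) (x [^] Suc n)"
        using xy by (simp add: lt_def)
      moreover have "x [^] n \<in> H" "x [^] Suc n \<in> H"
        using subgroup_nat_pow_closed[OF assms(1)] xy by blast+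
      ultimately have "lt y (x [^] Suc n)"
        using neg_trans xy(2) by blast
      then show ?thesis by (metis nat_pow_consistent)
    qed
  qed
qed

end

section \<open>Translation numbers and quasi-invariant measures\<close>

text \<open>The kernel of \<open>t\<close> consists of the elements of \<open>H\<close> with a fixed
  point; \<open>e\<close> keeps \<open>t\<close> from vanishing identically.\<close>

locale line_translation = line_action G \<phi> + subgroup H G
  for G (structure) and \<phi> and H +
  fixes t :: "'a \<Rightarrow> real" and e :: 'a
  assumes t_mult: "x \<in> H \<Longrightarrow> y \<in> H \<Longrightarrow> t (x \<otimes> y) = t x + t y"
    and t_pos_iff: "x \<in> H \<Longrightarrow> 0 < t x \<longleftrightarrow> lt \<one> x"
    and e: "e \<in> H" "lt \<one> e"
begin

lemma t_one [simp]: "t \<one> = 0"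
  using t_mult[of \<one> \<one>] by simp

lemma t_inv [simp]: "x \<in> H \<Longrightarrow> t (inv x) = - t x"
  using t_mult[of x "inv x"] by simp

lemma t_nat_pow [simp]: "x \<in> H \<Longrightarrow> t (x [^] (n::nat)) = real n * t x"
  by (induction n) (simp_all add: t_mult subgroup_nat_pow_closed[OF subgroup_axioms] algebra_simps)

lemma t_int_pow [simp]: "x \<in> H \<Longrightarrow> t (x [^] (m::int)) = of_int m * t x"
  by (cases m rule: int_cases2)
    (simp_all add: int_pow_int int_pow_neg_int subgroup_nat_pow_closed[OF subgroup_axioms])

lemma t_e_pos: "0 < t e"
  using e t_pos_iff by simp

lemma t_less_iff: "x \<in> H \<Longrightarrow> y \<in> H \<Longrightarrow> t x < t y \<longleftrightarrow> lt x y"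
  using t_pos_iff[of "inv x \<otimes> y"] lt_iff_lt_one[of x y] by (simp add: t_mult)

lemma t_le: "x \<in> H \<Longrightarrow> y \<in> H \<Longrightarrow> \<phi> x s \<le> \<phi> y s \<Longrightarrow> t x \<le> t y"
  by (metis lt_def not_less t_less_iff)

text \<open>Without a least positive element, positive values of \<open>t\<close> can be halved
  repeatedly; the multiples of a value smaller than \<open>b - a\<close> cannot all miss the
  interval.\<close>

lemma least_positive_or_dense:
  assumes "\<And>h. h \<in> H \<Longrightarrow> lt \<one> h \<Longrightarrow> \<exists>k\<in>H. lt \<one> k \<and> lt k h" and "a < b"
  shows "\<exists>h\<in>H. a < t h \<and> t h < b"
proof -
  have halve: "\<exists>h\<in>H. 0 < t h \<and> t h \<le> t e * (1/2) ^ n" for n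
  proof (induction n)
    case (Suc n)
    then obtain h where h: "h \<in> H" "0 < t h" "t h \<le> t e * (1/2) ^ n" by blast
    with assms(1)[of h] t_pos_iff obtain k where k: "k \<in> H" "0 < t k" "t k < t h"
      by (auto simp: t_less_iff)
    show ?case
    \<comment> \<open>The values of \<open>k\<close> and \<open>inv k \<otimes> h\<close> add up to
      \<open>t h\<close>, so one of them is at most half of it.\<close>
    proof (cases "t k \<le> t h / 2")
      case True
      then show ?thesis using h k by (intro bexI[of _ k]) auto
    next
      case False
      then show ?thesis using h k by (intro bexI[of _ "inv k \<otimes> h"]) (auto simp: t_mult)
    qed
  qed (use e t_e_pos in auto)
  have "\<exists>n. (1/2) ^ n < (b - a) / t e"
    using assms(2) t_e_pos by (intro real_arch_pow_inv) auto
  then obtain n where n: "(1/2) ^ n < (b - a) / t e" ..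
  then have "t e * (1/2) ^ n < b - a"
    using t_e_pos by (simp add: field_simps)
  with halve[of n] obtain h where h: "h \<in> H" "0 < t h" "t h < b - a" by force
  \<comment> \<open>The first multiple of \<open>t h\<close> beyond \<open>a\<close>; it exceeds
    \<open>a\<close> by at most \<open>t h\<close>, hence stays below \<open>b\<close>.\<close>
  define m where "m = \<lfloor>a / t h\<rfloor> + 1"
  have "of_int m - 1 \<le> a / t h" "a / t h < of_int m" by (simp_all add: m_def)
  then have "(of_int m - 1) * t h \<le> a" "a < of_int m * t h"
    using h by (simp_all add: field_simps)
  then have "a < t (h [^] m)" "t (h [^] m) < b"
    using h by (simp_all add: algebra_simps)
  moreover have "h [^] m \<in> H" by (rule subgroup_int_pow_closed[OF subgroup_axioms h(1)])
  ultimately show ?thesis by blast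
qed

section \<open>The distribution function of the invariant measure\<close>

definition F :: "real \<Rightarrow> real" where
  "F x = (INF h\<in>{h \<in> H. x < \<phi> h 0}. t h)"

lemma exists_above: "\<exists>h\<in>H. x < \<phi> h y"
  using lt_one_pow_unbounded[OF _ e(2)] mem_carrier[OF e(1)] subgroup_nat_pow_closed[OF subgroup_axioms e(1)] by blast

lemma exists_below: "\<exists>h\<in>H. \<phi> h y < x"
proof -
  obtain h where "h \<in> H" "y < \<phi> h x" using exists_above by blast
  then show ?thesis by (intro bexI[of _ "inv h"]) (auto simp: act_inv_less_iff)
qed

lemma bdd_below_F: "bdd_below (t ` {h \<in> H. x < \<phi> h 0})"
proof -
  obtain k where "k \<in> H" "\<phi> k 0 < x" using exists_below by blast
  then show ?thesis by (intro bdd_belowI2[of _ "t k"]) (auto intro: t_le[of _ _ 0])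
qed

lemma F_le: "h \<in> H \<Longrightarrow> x < \<phi> h 0 \<Longrightarrow> F x \<le> t h"
  unfolding F_def using bdd_below_F by (intro cINF_lower) auto

lemma F_greatest: "(\<And>h. h \<in> H \<Longrightarrow> x < \<phi> h 0 \<Longrightarrow> c \<le> t h) \<Longrightarrow> c \<le> F x"
  unfolding F_def using exists_above[of x 0] by (intro cINF_greatest) auto

lemma F_mono: "x \<le> y \<Longrightarrow> F x \<le> F y"
  by (rule F_greatest) (auto intro: F_le)

text \<open>Left multiplication by \<open>h\<close> shifts the index set of the infimum; the reverse
  inequality is the same one for \<open>inv h\<close>.\<close>

lemma F_act:
  assumes "h \<in> H"
  shows "F (\<phi> h x) = t h + F x"
proof -
  have le: "F (\<phi> h x) \<le> t h + F x" if "h \<in> H" for h x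
  proof -
    have "F (\<phi> h x) - t h \<le> F x"
    proof (rule F_greatest)
      fix k assume "k \<in> H" "x < \<phi> k 0"
      then show "F (\<phi> h x) - t h \<le> t k"
        using F_le[of "h \<otimes> k" "\<phi> h x"] that by (simp add: t_mult)
    qed
    then show ?thesis by simp
  qed
  show ?thesis
    using le[OF assms, of x] le[of "inv h" "\<phi> h x"] assms by simp
qed

text \<open>The inequality \<open>x < \<phi> h 0\<close> in \<open>F\<close> is strict, so an
  \<open>h\<close> that nearly attains the infimum at \<open>x\<close> still competes slightly to
  the right of \<open>x\<close>.\<close>

lemma F_right_continuous: "continuous (at_right x) F"
proof -
  have "\<forall>\<epsilon>>0. \<exists>\<delta>>0. F (x + \<delta>) - F x < \<epsilon>"
  proof (intro allI impI)
    fix \<epsilon> :: real assume "0 < \<epsilon>"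
    have "\<exists>h\<in>H. x < \<phi> h 0 \<and> t h < F x + \<epsilon>"
    proof (rule ccontr)
      assume none: "\<not> ?thesis"
      have "F x + \<epsilon> \<le> F x"
      proof (rule F_greatest)
        fix h assume "h \<in> H" "x < \<phi> h 0"
        with none have "\<not> t h < F x + \<epsilon>" by blast
        then show "F x + \<epsilon> \<le> t h" by linarith
      qed
      with \<open>0 < \<epsilon>\<close> show False by simp
    qed
    then obtain h where h: "h \<in> H" "x < \<phi> h 0" "t h < F x + \<epsilon>" by blast
    obtain y where y: "x < y" "y < \<phi> h 0" using dense[OF h(2)] by blast
    then have "F y \<le> t h" by (intro F_le h(1))
    with y h(3) show "\<exists>\<delta>>0. F (x + \<delta>) - F x < \<epsilon>"
      by (intro exI[of _ "y - x"]) auto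
  qed
  then show ?thesis
    using continuous_at_right_real_increasing[of F x] F_mono by blast
qed

text \<open>A rational \<open>m / n\<close> strictly between \<open>t h / t e\<close> and
  \<open>s h / s e\<close> would make exactly one of \<open>t\<close> and \<open>s\<close> positive
  at \<open>h [^] n \<otimes> e [^] (- m)\<close>, although both have the same positive
  elements.\<close>

lemma proportional:
  assumes "\<And>x y. x \<in> H \<Longrightarrow> y \<in> H \<Longrightarrow> s (x \<otimes> y) = s x + s y"
    and "\<And>x. x \<in> H \<Longrightarrow> 0 < s x \<longleftrightarrow> lt \<one> x" and h: "h \<in> H"
  shows "s h = s e / t e * t h"
proof -
  interpret S: line_translation G \<phi> H s e
    using assms e by unfold_locales
  have t_s: "0 < t x \<longleftrightarrow> 0 < s x" if "x \<in> H" for x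
    using that t_pos_iff S.t_pos_iff by simp
  have "t h / t e = s h / s e"
  proof (rule ccontr)
    assume "t h / t e \<noteq> s h / s e"
    then obtain q where q: "q \<in> \<rat>" "t h / t e < q \<and> q < s h / s e \<or> s h / s e < q \<and> q < t h / t e"
      using Rats_dense_in_real by (metis linorder_neqE_linordered_idom)
    obtain m and n :: nat where mn: "n \<noteq> 0" "q = of_int m / real n"
      using q(1) by (auto simp: Rats_eq_int_div_nat)
    define x where "x = h [^] n \<otimes> e [^] (- m)"
    have mem: "h [^] n \<in> H" "e [^] (- m) \<in> H"
      using h e subgroup_nat_pow_closed[OF subgroup_axioms] subgroup_int_pow_closed[OF subgroup_axioms] by blast+
    then have x: "x \<in> H" by (simp add: x_def)
    have vals: "t x = real n * t h - of_int m * t e" "s x = real n * s h - of_int m * s e"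
      using h e mem by (simp_all only: x_def t_mult S.t_mult t_nat_pow S.t_nat_pow t_int_pow S.t_int_pow of_int_minus mult_minus_left diff_conv_add_uminus)
    have qn: "of_int m = q * real n" and n: "0 < real n" using mn by simp_all
    have val: "t x = real n * t e * (t h / t e - q)" "s x = real n * s e * (s h / s e - q)"
      unfolding vals qn using t_e_pos S.t_e_pos by (simp_all add: algebra_simps)
    have "0 < t x \<longleftrightarrow> q < t h / t e"
      unfolding val using mult_less_cancel_left_pos[of "real n * t e" 0 "t h / t e - q"] n t_e_pos by simp
    moreover have "0 < s x \<longleftrightarrow> q < s h / s e"
      unfolding val using mult_less_cancel_left_pos[of "real n * s e" 0 "s h / s e - q"] n S.t_e_pos by simp
    ultimately show False
      using q(2) t_s[OF x] by linarith
  qed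
  then show ?thesis
    using t_e_pos S.t_e_pos by (simp add: field_simps)
qed

text \<open>If \<open>A x < B x\<close>, density gives \<open>h\<close> with \<open>t h\<close>
  strictly between. As \<open>A\<close> and \<open>B\<close> both take the value \<open>t h\<close>
  at \<open>\<phi> h 0\<close>, the position of this point relative to \<open>x\<close> contradicts
  the monotonicity of one of them.\<close>

lemma equivariant_unique:
  assumes dense: "\<And>a b. a < b \<Longrightarrow> \<exists>h\<in>H. a < t h \<and> t h < b"
    and A: "mono A" "A 0 = 0" "\<And>h x. h \<in> H \<Longrightarrow> A (\<phi> h x) = t h + A x"
    and B: "mono B" "B 0 = 0" "\<And>h x. h \<in> H \<Longrightarrow> B (\<phi> h x) = t h + B x"
  shows "A x = (B x :: real)"
proof (rule ccontr)
  have wlog: False if less: "A x < B x" and A: "mono A" "A 0 = 0" "\<And>h x. h \<in> H \<Longrightarrow> A (\<phi> h x) = t h + A x"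
    and B: "mono B" "B 0 = 0" "\<And>h x. h \<in> H \<Longrightarrow> B (\<phi> h x) = t h + B x" for A B :: "real \<Rightarrow> real"
  proof -
    obtain h where h: "h \<in> H" "A x < t h" "t h < B x" using dense less by blast
    show False
    proof (cases "\<phi> h 0 \<le> x")
      case True
      then have "A (\<phi> h 0) \<le> A x" using A(1) by (rule monoD[rotated])
      then show False using A h by simp
    next
      case False
      then have "B x \<le> B (\<phi> h 0)" using B(1) by (intro monoD[of B]) simp_all
      then show False using B h by simp
    qed
  qed
  assume "A x \<noteq> B x"
  then show False
    using wlog[of A B] wlog[of B A] A B by (meson linorder_neqE_linordered_idom)
qed

text \<open>Conjugation by \<open>g\<close> multiplies \<open>t\<close> by a constant
  \<open>c\<close>, so \<open>F\<close> composed with \<open>\<phi> g\<close> and divided by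
  \<open>c\<close> obeys the same equivariance as \<open>F\<close>; uniqueness leaves only an
  additive constant.\<close>

lemma F_affine:
  assumes dense: "\<And>a b. a < b \<Longrightarrow> \<exists>h\<in>H. a < t h \<and> t h < b"
    and "H \<lhd> G" and g: "g \<in> carrier G"
  shows "\<exists>c>0. \<exists>b. \<forall>x. F (\<phi> g x) = c * F x + b"
proof -
  interpret N: normal H G by fact
  define s where "s h = t (g \<otimes> h \<otimes> inv g)" for h
  have conj: "g \<otimes> h \<otimes> inv g \<in> H" if "h \<in> H" for h
    using g that by (rule N.inv_op_closed2)
  have s_mult: "s (x \<otimes> y) = s x + s y" if "x \<in> H" "y \<in> H" for x y
  proof -
    have "g \<otimes> (x \<otimes> y) \<otimes> inv g = (g \<otimes> x \<otimes> inv g) \<otimes> (g \<otimes> y \<otimes> inv g)"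
      using that g by (simp add: m_assoc inv_solve_left)
    then show ?thesis using conj that by (simp add: s_def t_mult)
  qed
  have s_pos: "0 < s x \<longleftrightarrow> lt \<one> x" if "x \<in> H" for x
    using that g conj by (simp add: s_def t_pos_iff lt_one_conj)
  define c where "c = s e / t e"
  have s: "s h = c * t h" if "h \<in> H" for h
    unfolding c_def by (rule proportional) (use s_mult s_pos that in auto)
  have "0 < c" using s_pos[OF e(1)] e t_e_pos by (simp add: c_def)
  have act: "F (\<phi> g (\<phi> h x)) = c * t h + F (\<phi> g x)" if "h \<in> H" for h x
  proof -
    have "\<phi> g (\<phi> h x) = \<phi> (g \<otimes> h \<otimes> inv g) (\<phi> g x)"
      using that g by simp
    then show ?thesis using F_act[OF conj[OF that]] s[OF that] by (simp add: s_def)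
  qed
  \<comment> \<open>Both sides are normalized to vanish at \<open>0\<close>, as
    \<open>equivariant_unique\<close> demands.\<close>
  have "(F (\<phi> g x) - F (\<phi> g 0)) / c = F x - F 0" for x
    by (rule equivariant_unique[OF dense])
      (use \<open>0 < c\<close> g in \<open>auto simp: act F_act field_simps intro!: monoI F_mono\<close>)
  then have "F (\<phi> g x) = c * F x + (F (\<phi> g 0) - c * F 0)" for x
    using \<open>0 < c\<close> by (simp add: field_simps)
  with \<open>0 < c\<close> show ?thesis by blast
qed

end

text \<open>For the Stieltjes measure of \<open>F\<close>, an affine change of \<open>F\<close>
  rescales the mass of every half-open interval by the same factor, and these intervals determine
  the measure.\<close>

lemma (in line_action) quasi_preserved_interval_measure:
  fixes F :: "real \<Rightarrow> real"
  assumes F: "mono F" "\<And>x. continuous (at_right x) F" and ab: "F a < F b"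
    and affine: "\<And>g. g \<in> carrier G \<Longrightarrow> \<exists>c>0. \<exists>b. \<forall>x. F (\<phi> g x) = c * F x + b"
  shows "\<exists>M. radon_measure M \<and> emeasure M UNIV \<noteq> 0 \<and> quasi_preserved G \<phi> M"
proof -
  define M where "M = interval_measure F"
  have M_Ioc: "emeasure M {x<..y} = ennreal (F y - F x)" if "x \<le> y" for x y
    unfolding M_def using that F by (intro emeasure_interval_measure_Ioc) (auto dest: monoD)
  have sets_M: "sets M = sets borel" by (simp add: M_def)
  have "emeasure M K < \<infinity>" if K: "compact K" for K
  proof -
    obtain r where r: "\<And>x. x \<in> K \<Longrightarrow> \<bar>x\<bar> \<le> r"
      using compact_imp_bounded[OF K] by (auto simp: bounded_real)
    \<comment> \<open>The left endpoint is excluded, hence the extra \<open>1\<close>; the absolute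
      value covers a negative \<open>r\<close>, possible when \<open>K\<close> is empty.\<close>
    have "K \<subseteq> {- (\<bar>r\<bar> + 1)<..\<bar>r\<bar> + 1}" using r by fastforce
    then have "emeasure M K \<le> emeasure M {- (\<bar>r\<bar> + 1)<..\<bar>r\<bar> + 1}"
      by (intro emeasure_mono) (simp_all add: sets_M)
    also have "\<dots> < \<infinity>" by (subst M_Ioc) auto
    finally show ?thesis .
  qed
  then have "radon_measure M" by (simp add: radon_measure_def sets_M)
  moreover have "emeasure M UNIV \<noteq> 0"
  proof -
    have "a \<le> b" using ab monoD[OF F(1), of b a] by (meson linear not_less)
    then have "0 < emeasure M {a<..b}" using ab by (simp add: M_Ioc)
    also have "\<dots> \<le> emeasure M UNIV" by (intro emeasure_mono) (simp_all add: sets_M)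
    finally show ?thesis by simp
  qed
  moreover have "quasi_preserved G \<phi> M"
    unfolding quasi_preserved_def
  proof
    fix g assume g: "g \<in> carrier G"
    \<comment> \<open>\<open>quasi_preserved\<close> measures preimages, and the preimage of an
      interval under \<open>\<phi> g\<close> has its endpoints moved by
      \<open>inv g\<close>.\<close>
    then obtain c d where c: "0 < c" "\<And>x. F (\<phi> (inv g) x) = c * F x + d"
      using affine[of "inv g"] by auto
    have meas: "\<phi> g \<in> measurable M borel"
      using borel_measurable_continuous_onI[OF act_continuous[OF g]]
      by (simp add: measurable_cong_sets[OF sets_M refl])
    have "distr M borel (\<phi> g) = scale_measure (ennreal c) M"
    proof (rule measure_eqI_generator_eq)
      let ?E = "range (\<lambda>(x, y). {x<..y :: real})"
      show "Int_stable ?E"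
        by (auto simp: Int_stable_def Int_greaterThanAtMost)
      show "sets (distr M borel (\<phi> g)) = sigma_sets UNIV ?E" "sets (scale_measure (ennreal c) M) = sigma_sets UNIV ?E"
        by (simp_all add: sets_M borel_sigma_sets_Ioc)
      have vimage: "\<phi> g -` {x<..y} = {\<phi> (inv g) x<..\<phi> (inv g) y}" for x y
      proof -
        have "z \<le> \<phi> (inv g) y \<longleftrightarrow> \<phi> g z \<le> y" for z
          using g by (metis act_inv(2) act_le_iff)
        then show ?thesis using g by (auto simp: act_inv_less_iff)
      qed
      have distr_Ioc: "emeasure (distr M borel (\<phi> g)) {x<..y} = ennreal (c * (F y - F x))" if "x \<le> y" for x y
      proof -
        have "emeasure (distr M borel (\<phi> g)) {x<..y} = emeasure M {\<phi> (inv g) x<..\<phi> (inv g) y}"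
          using meas by (simp add: emeasure_distr vimage M_def)
        also have "\<dots> = ennreal (F (\<phi> (inv g) y) - F (\<phi> (inv g) x))"
          using g that by (intro M_Ioc) simp
        finally show ?thesis by (simp add: c(2) algebra_simps)
      qed
      show "emeasure (distr M borel (\<phi> g)) B = emeasure (scale_measure (ennreal c) M) B" if B: "B \<in> ?E" for B
      proof -
        obtain x y where xy: "B = {x<..y}" using B by auto
        show ?thesis
        proof (cases "x \<le> y")
          case True
          then show ?thesis
            using c(1) monoD[OF F(1) True] by (simp add: xy distr_Ioc M_Ioc ennreal_mult)
        qed (simp add: xy)
      qed
      show "range (\<lambda>n. {- real n<..real n}) \<subseteq> ?E" by auto
      show "(\<Union>n. {- real n<..real n}) = UNIV"
      proof safe
        fix x :: real
        obtain n :: nat where "\<bar>x\<bar> < real n" using reals_Archimedean2 by blast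
        then show "x \<in> (\<Union>n. {- real n<..real n})" by (intro UN_I[of n]) auto
      qed simp
      show "emeasure (distr M borel (\<phi> g)) {- real n<..real n} \<noteq> \<infinity>" for n
        by (subst distr_Ioc) auto
    qed simp
    then have "emeasure M (\<phi> g -` B) = ennreal c * emeasure M B" if "B \<in> sets borel" for B
      using arg_cong[where f = "\<lambda>N. emeasure N B"] emeasure_distr[OF meas that]
      by (simp add: M_def)
    then show "\<exists>c. \<forall>B\<in>sets borel. emeasure M (\<phi> g -` B) = ennreal c * emeasure M B"
      by blast
  qed
  ultimately show ?thesis by blast
qed

section \<open>Passing to larger terms of the normal series\<close>

context line_action
begin

lemma coherent_imp_line_translation:
  assumes "subgroup H G" "coherent H" and e: "e \<in> H" "lt \<one> e"
  shows "\<exists>t. line_translation G \<phi> H t e"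
proof -
  interpret H: subgroup H G by fact
  interpret A: archimedean_ordered_group "G\<lparr>carrier := H\<rparr>" lt
    using assms(1,2) by (rule coherent_archimedean)
  obtain t :: "'a \<Rightarrow> real" where t: "\<And>x y. x \<in> H \<Longrightarrow> y \<in> H \<Longrightarrow> t (x \<otimes> y) = t x + t y"
    "\<And>x. x \<in> H \<Longrightarrow> 0 < t x \<longleftrightarrow> lt \<one> x"
    using A.hoelder[of e] e by auto
  have "line_translation G \<phi> H t e"
    using t e by unfold_locales
  then show ?thesis by blast
qed

text \<open>On the fixed set \<open>E\<close> of the kernel \<open>Z\<close>, the least positive
  \<open>e\<close> commutes with all of \<open>G\<close>. A ping-pong interval of \<open>H'\<close>
  then lies between \<open>u\<close> and \<open>\<phi> e u\<close>, too short for an element of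
  \<open>H\<close> to identify two different word images in it.\<close>

lemma coherent_extension:
  assumes "H \<lhd> G" "subgroup H' G" "H \<subseteq> H'" "coherent H" "word_coincident H' H"
    and e: "e \<in> H" "lt \<one> e" and least: "\<And>h. h \<in> H \<Longrightarrow> lt \<one> h \<Longrightarrow> \<not> lt h e"
  shows "coherent H'"
proof -
  interpret H: normal H G by fact
  interpret H': subgroup H' G by fact
  have eG [simp]: "e \<in> carrier G" using e by simp
  define Z where "Z = {z \<in> H. has_fix z}"
  have Z_sub: "subgroup Z G"
  proof (rule subgroupI)
    show "Z \<noteq> {}" using H.one_closed by (auto simp: Z_def has_fix_def intro!: exI[of _ \<one>])
    show "inv a \<in> Z" if "a \<in> Z" for a using that by (simp add: Z_def)
    show "a \<otimes> b \<in> Z" if "a \<in> Z" "b \<in> Z" for a b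
      using that assms(4) by (simp add: Z_def coherent_def)
  qed (use H.subset in \<open>auto simp: Z_def\<close>)
  have Z_G: "Z \<subseteq> carrier G" using H.subset by (auto simp: Z_def)
  have no_fix_e: "\<not> has_fix e" using e has_fix_not_lt by blast
  \<comment> \<open>This bounds the \<open>Z\<close>-orbit of \<open>0\<close> by
    \<open>\<phi> e 0\<close>, which produces a common fixed point of \<open>Z\<close>.\<close>
  have "lt z e" if z: "z \<in> Z" for z
  proof -
    have zH: "z \<in> H" "has_fix z" using z by (simp_all add: Z_def)
    define k where "k = inv z \<otimes> e"
    have k: "k \<in> H" "z \<otimes> k = e" using zH e by (simp_all add: k_def m_assoc[symmetric])
    then have "\<not> has_fix k" using zH assms(4) no_fix_e by (auto simp: coherent_def)
    moreover have "\<not> lt k \<one>"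
    proof
      assume "lt k \<one>"
      then have less: "\<phi> z (\<phi> k s) < \<phi> z s" for s using zH by (simp add: lt_def)
      obtain s where s: "\<phi> z s = s" using zH by (auto simp: has_fix_def)
      have "\<phi> z (\<phi> k s) = \<phi> e s" using k zH act_mult[of z k s] by simp
      moreover have "s < \<phi> e s" using e by (simp add: lt_def)
      ultimately show False using s less[of s] by simp
    qed
    ultimately have "lt \<one> k" using fix_or_lt[of k] k by auto
    then show "lt z e" using lt_iff_lt_one[of z e] zH by (simp add: k_def)
  qed
  then have "Fix Z \<noteq> {}"
    by (intro bounded_orbit_imp_Fix[OF Z_sub, of 0 "\<phi> e 0"]) (auto simp: lt_def less_imp_le)
  define E where "E = Fix Z"
  have E: "closed E" "E \<noteq> {}" "invariant (carrier G) E"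
  proof -
    show "closed E" unfolding E_def using Z_G by (rule closed_Fix)
    show "E \<noteq> {}" using \<open>Fix Z \<noteq> {}\<close> by (simp add: E_def)
    have "g \<otimes> z \<otimes> inv g \<in> Z" if "g \<in> carrier G" "z \<in> Z" for g z
      using that H.inv_op_closed2[of g z] by (simp add: Z_def)
    then show "invariant (carrier G) E"
      unfolding E_def using Z_G by (intro invariant_Fix)
  qed
  have Z_eq: "\<phi> a x = \<phi> b x" if "a \<in> H" "b \<in> H" "has_fix (inv a \<otimes> b)" "x \<in> E" for a b x
  proof -
    have "\<phi> (inv a \<otimes> b) x = x" using that by (auto simp: E_def Fix_def Z_def)
    then have "\<phi> (inv a) (\<phi> b x) = x" using that by simp
    then show ?thesis using that by (metis H.mem_carrier act_inv(2))
  qed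
  have commute: "\<phi> g (\<phi> e x) = \<phi> e (\<phi> g x)" if g: "g \<in> carrier G" and x: "x \<in> E" for g x
  proof -
    define c where "c = g \<otimes> e \<otimes> inv g"
    have c: "c \<in> H" "lt \<one> c" using g e H.inv_op_closed2[of g e] by (simp_all add: c_def lt_one_conj)
    \<comment> \<open>The conjugate in the other direction excludes \<open>lt e c\<close>, which
      would put \<open>c'\<close> below the least positive \<open>e\<close>. So \<open>c\<close> and
      \<open>e\<close> are incomparable and agree on \<open>E\<close>.\<close>
    define c' where "c' = inv g \<otimes> e \<otimes> g"
    have c': "c' \<in> H" "lt \<one> c'"
      using g e H.inv_op_closed2[of "inv g" e] lt_one_conj[of "inv g" e] by (simp_all add: c'_def)
    have "\<not> lt e c"
    proof
      assume "lt e c"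
      have "\<phi> c' y < \<phi> e y" for y
      proof -
        have "\<phi> e (\<phi> g y) < \<phi> g (\<phi> e y)"
          using \<open>lt e c\<close> g by (simp add: lt_def c_def) (metis act_inv(1))
        then show ?thesis using g by (simp add: c'_def act_inv_less_iff)
      qed
      then have "lt c' e" by (simp add: lt_def)
      with least[OF c'] show False by simp
    qed
    moreover have "\<not> lt c e" using least[OF c] .
    moreover have "lt c e \<longleftrightarrow> lt \<one> (inv c \<otimes> e)" using c by (intro lt_iff_lt_one) auto
    moreover have "lt e c \<longleftrightarrow> lt (inv c \<otimes> e) \<one>"
      using c by (simp add: lt_def act_inv_less_iff)
    ultimately have "has_fix (inv c \<otimes> e)" using fix_or_lt[of "inv c \<otimes> e"] c by auto
    then have "\<phi> c y = \<phi> e y" if "y \<in> E" for y using Z_eq that c e by blast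
    then have "\<phi> c (\<phi> g x) = \<phi> e (\<phi> g x)" using E(3) g x by (simp add: invariant_def)
    then show ?thesis using g by (simp add: c_def)
  qed
  have "ping_pong_free H' E"
    unfolding ping_pong_free_def
  proof (intro ballI impI, rule ccontr)
    fix f g u v
    assume fg: "f \<in> H'" "g \<in> H'" and uv: "u \<in> E" "v \<in> E" "u < v" "\<phi> f u = u" "\<phi> g v = v"
      and nofix: "\<forall>x\<in>E. u < x \<and> x \<le> v \<longrightarrow> \<phi> f x \<noteq> x" and "\<not> \<phi> g u \<le> \<phi> f v"
    then have less: "\<phi> f v < \<phi> g u" by simp
    have fgG: "f \<in> carrier G" "g \<in> carrier G" using fg by auto
    \<comment> \<open>By commutation \<open>\<phi> e u\<close> is a further fixed point of
      \<open>f\<close> in \<open>E\<close>, so it must lie beyond \<open>v\<close>.\<close>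
    have "\<phi> f (\<phi> e u) = \<phi> e u" using commute[OF fgG(1) uv(1)] uv by simp
    moreover have "\<phi> e u \<in> E" using E(3) uv by (simp add: invariant_def)
    moreover have "u < \<phi> e u" using e by (simp add: lt_def)
    ultimately have v_less: "v < \<phi> e u" using nofix by force
    \<comment> \<open>By minimality, a positive \<open>c\<close> either agrees with \<open>e\<close>
      on \<open>E\<close> or lies above \<open>e\<close> everywhere; in both cases it pushes points
      of \<open>E\<close> out of the interval.\<close>
    have far: "\<phi> c y' \<notin> {u..<v}" if c: "c \<in> H" "lt \<one> c" and y': "y' \<in> {u..<v}" "y' \<in> E" for c y'
    proof -
      have "\<phi> e y' \<le> \<phi> c y'"
      proof (cases "has_fix (inv e \<otimes> c)")
        case True
        then show ?thesis using Z_eq[OF e(1) c(1) True y'(2)] by simp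
      next
        case False
        have "\<not> lt (inv e \<otimes> c) \<one>"
        proof
          assume "lt (inv e \<otimes> c) \<one>"
          then have "lt c e" using c by (simp add: lt_def act_inv_less_iff)
          with least[OF c] show False by simp
        qed
        with False have "lt \<one> (inv e \<otimes> c)" using fix_or_lt[of "inv e \<otimes> c"] c by auto
        then show ?thesis using c lt_iff_lt_one[of e c] by (simp add: lt_def less_imp_le)
      qed
      moreover have "\<phi> e u \<le> \<phi> e y'" using y' by simp
      ultimately have "v < \<phi> c y'" using v_less by linarith
      then show ?thesis by simp
    qed
    have "\<exists>w w' k. length w = length w' \<and> w \<noteq> w' \<and> k \<in> H \<and> word_eval G f g w = word_eval G f g w' \<otimes> k"
      using assms(5) fg by (simp only: word_coincident_def)
    then obtain w w' k where w: "length w = length w'" "w \<noteq> w'" "k \<in> H"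
      and eq: "word_eval G f g w = word_eval G f g w' \<otimes> k"
      by (elim exE conjE)
    define a where "a = word_eval G f g w"
    define b where "b = word_eval G f g w'"
    have abG: "a \<in> carrier G" "b \<in> carrier G" using fgG by (simp_all add: a_def b_def)
    note pp = ping_pong_words[OF fgG uv(3) eq_refl[OF uv(4)[symmetric]] eq_refl[OF uv(5)] less]
    have range: "\<phi> a u \<in> {u..<v}" "\<phi> b u \<in> {u..<v}"
      using pp(1)[of w] pp(1)[of w'] by (simp_all add: a_def b_def)
    have neq: "\<phi> a u \<noteq> \<phi> b u"
      unfolding a_def b_def by (rule pp(2)[OF w(1,2)])
    have inE: "\<phi> a u \<in> E" "\<phi> b u \<in> E" using E(3) abG uv by (simp_all add: invariant_def)
    \<comment> \<open>Conjugation by \<open>b\<close> moves the discrepancy to the left of the word,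
      so that \<open>c\<close> carries \<open>\<phi> b u\<close> to the different point
      \<open>\<phi> a u\<close> of the same interval.\<close>
    define c where "c = b \<otimes> k \<otimes> inv b"
    have c: "c \<in> H" unfolding c_def using abG w by (intro H.inv_op_closed2) auto
    have "a = c \<otimes> b" using eq abG w by (simp add: c_def a_def[symmetric] b_def[symmetric] m_assoc)
    then have ac: "\<phi> a u = \<phi> c (\<phi> b u)" using c abG by simp
    then have ac': "\<phi> b u = \<phi> (inv c) (\<phi> a u)" using c by simp
    consider "has_fix c" | "lt \<one> c" | "lt \<one> (inv c)" using fix_or_lt[of c] c lt_one_inv[of c] by auto
    then show False
    proof cases
      case 1
      then have "\<phi> c (\<phi> b u) = \<phi> b u" using inE c by (auto simp: E_def Fix_def Z_def)
      with ac neq show False by simp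
    next
      case 2
      from far[OF c 2 range(2) inE(2)] range(1) ac show False by simp
    next
      case 3
      from far[OF H.m_inv_closed[OF c] 3 range(1) inE(1)] range(2) ac' show False by simp
    qed
  qed
  moreover have "invariant H' E" using E(3) H'.subset by (auto simp: invariant_def)
  ultimately show ?thesis
    using coherent_if_ping_pong_free[OF assms(2) E(1,2)] by blast
qed

text \<open>On \<open>Fix K\<close> every coincidence modulo \<open>K\<close> becomes exact, which
  excludes ping-pong. The fixed-point-free element of \<open>H\<close> comes from comparison with
  \<open>T\<close>, which itself need not belong to \<open>H\<close>.\<close>

lemma coherent_with_free_element:
  assumes "H \<lhd> G" "K \<lhd> G" "word_coincident H K" "Fix K \<noteq> {}" "Fix H = {}"
    and T: "T \<in> carrier G" "lt \<one> T"
  shows "coherent H \<and> (\<exists>e\<in>H. lt \<one> e)"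
proof -
  interpret H: normal H G by fact
  interpret K: normal K G by fact
  define E where "E = Fix K"
  have E: "closed E" "E \<noteq> {}" "invariant (carrier G) E"
    using assms(4) closed_Fix[OF K.subset] invariant_Fix[OF K.subset K.inv_op_closed2] by (auto simp: E_def)
  have npp: "\<phi> g u \<le> \<phi> f v"
    if "f \<in> H" "g \<in> H" "u \<in> E" "v \<in> E" "u < v" "u \<le> \<phi> f u" "\<phi> g v \<le> v" for f g u v
    using no_ping_pong_on_Fix[OF H.subgroup_axioms K.subset assms(3)] that by (simp add: E_def)
  have "ping_pong_free H E"
    unfolding ping_pong_free_def by (intro ballI impI npp) simp_all
  moreover have "invariant H E" using E(3) H.subset by (auto simp: invariant_def)
  ultimately have coh: "coherent H"
    using coherent_if_ping_pong_free[OF H.subgroup_axioms E(1,2)] by blast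
  obtain x where x: "x \<in> E" using E by blast
  \<comment> \<open>Otherwise \<open>\<phi> T x\<close> would bound the \<open>H\<close>-orbit of
    \<open>x\<close>, and \<open>H\<close> would have a common fixed point.\<close>
  have "\<exists>h\<in>H. \<phi> T x < \<phi> h x"
    using bounded_orbit_imp_Fix[OF H.subgroup_axioms, of x "\<phi> T x"] assms(5) by (meson not_less)
  then obtain h where h: "h \<in> H" "\<phi> T x < \<phi> h x" by blast
  have "\<not> has_fix h"
    using assms(1) E(1,3) T h(1) x h(2) npp by (rule fixed_point_free_if_displacement)
  then have "lt \<one> h \<or> lt \<one> (inv h)" using fix_or_lt[of h] h lt_one_inv[of h] by auto
  then show ?thesis using coh h H.m_inv_closed by blast
qed

text \<open>The function \<open>F\<close> changes by a translation under elements of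
  \<open>H\<close>, and by an affine map under all of \<open>G\<close> in the dense case.\<close>

lemma quasi_preserved_measure_if_dense_or_full:
  assumes "H \<lhd> G" "line_translation G \<phi> H t e"
    and "H = carrier G \<or> (\<forall>a b. a < b \<longrightarrow> (\<exists>h\<in>H. a < t h \<and> t h < b))"
  shows "\<exists>M. radon_measure M \<and> emeasure M UNIV \<noteq> 0 \<and> quasi_preserved G \<phi> M"
proof -
  interpret L: line_translation G \<phi> H t e by fact
  show ?thesis
  proof (rule quasi_preserved_interval_measure)
    show "mono L.F" by (rule monoI) (rule L.F_mono)
    show "continuous (at_right x) L.F" for x by (rule L.F_right_continuous)
    show "L.F 0 < L.F (\<phi> e 0)" using L.F_act[OF L.e(1)] L.t_e_pos by simp
    show "\<exists>c>0. \<exists>b. \<forall>x. L.F (\<phi> g x) = c * L.F x + b" if g: "g \<in> carrier G" for g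
      using assms(3)
    proof
      assume "H = carrier G"
      then have "\<forall>x. L.F (\<phi> g x) = 1 * L.F x + t g" using L.F_act g by simp
      then show ?thesis by (intro exI[of _ 1] exI[of _ "t g"] conjI) simp_all
    next
      assume "\<forall>a b. a < b \<longrightarrow> (\<exists>h\<in>H. a < t h \<and> t h < b)"
      then show ?thesis by (intro L.F_affine assms(1) g) blast
    qed
  qed
qed

end

section \<open>Ascent along the normal series\<close>

theorem theoremA:
  fixes G :: "('a, 'b) monoid_scheme" and \<phi> :: "'a \<Rightarrow> real \<Rightarrow> real" and T :: 'a
  assumes "group G"
    and "class_S G"
    and "order_pres_action G \<phi>"
    and "T \<in> carrier G"
    and "\<forall>x. \<phi> T x \<noteq> x"
  shows "\<exists>M :: real measure. radon_measure M \<and> emeasure M UNIV \<noteq> 0 \<and> quasi_preserved G \<phi> M"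
proof -
  interpret group G by fact
  interpret line_action G \<phi> by unfold_locales fact
  obtain N d where N: "N 0 = carrier G" "N (Suc d) = {\<one>\<^bsub>G\<^esub>}" "\<And>i. i \<le> Suc d \<Longrightarrow> N i \<lhd> G"
    "\<And>i. i \<le> d \<Longrightarrow> N (Suc i) \<subseteq> N i"
    "\<And>i. i \<le> d \<Longrightarrow> locally_subexp_growth ((G\<lparr>carrier := N i\<rparr>) Mod N (Suc i))"
    using assms(2) unfolding class_S_def by blast
  have coincident: "word_coincident (N i) (N (Suc i))" if "i \<le> d" for i
    using word_coincident_if_locally_subexp_growth[OF N(3) N(3) N(4,5)] that by simp
  have "\<not> has_fix T" using assms(5) by (simp add: has_fix_def)
  then have "lt \<one>\<^bsub>G\<^esub> T \<or> lt \<one>\<^bsub>G\<^esub> (inv\<^bsub>G\<^esub> T)"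
    using fix_or_lt[OF assms(4)] lt_one_inv[OF assms(4)] by blast
  then obtain T' where T': "T' \<in> carrier G" "lt \<one>\<^bsub>G\<^esub> T'" using assms(4) inv_closed by blast
  \<comment> \<open>\<open>Fix\<close> grows along the descending series, so the term just before
    \<open>N m\<close> is the last one without a common fixed point.\<close>
  define m where "m = (LEAST i. Fix (N i) \<noteq> {})"
  have ex: "Fix (N (Suc d)) \<noteq> {}" by (simp add: N(2) Fix_def)
  have m: "Fix (N m) \<noteq> {}" "m \<le> Suc d"
    unfolding m_def using LeastI[of "\<lambda>i. Fix (N i) \<noteq> {}", OF ex] Least_le[of "\<lambda>i. Fix (N i) \<noteq> {}", OF ex] by blast+
  have "Fix (N 0) = {}" using assms(4,5) by (auto simp: N(1) Fix_def)
  then obtain k where k: "m = Suc k" using m(1) by (cases m) auto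
  have "Fix (N k) = {}" using not_less_Least[of k "\<lambda>i. Fix (N i) \<noteq> {}"] k by (auto simp: m_def)
  then have base: "coherent (N k) \<and> (\<exists>e\<in>N k. lt \<one>\<^bsub>G\<^esub> e)"
    using m k N(3) coincident T' by (intro coherent_with_free_element[of "N k" "N (Suc k)" T']) auto
  \<comment> \<open>Descending from index \<open>k\<close> to \<open>0\<close> ascends the series.
    The free element varies in the induction, since each step hands on a least positive one.\<close>
  have "?thesis" if "j \<le> d" "coherent (N j)" "e \<in> N j" "lt \<one>\<^bsub>G\<^esub> e" for j e
    using that
  proof (induction j arbitrary: e)
    case 0
    have "N 0 \<lhd> G" by (rule N(3)) simp
    moreover obtain t where "line_translation G \<phi> (N 0) t e"
      using coherent_imp_line_translation[OF normal_imp_subgroup[OF \<open>N 0 \<lhd> G\<close>] 0(2-4)] by blast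
    ultimately show ?case
      by (rule quasi_preserved_measure_if_dense_or_full) (simp add: N(1))
  next
    case (Suc j)
    have nor: "N (Suc j) \<lhd> G" "N j \<lhd> G" using Suc.prems by (auto intro: N(3))
    obtain t where t: "line_translation G \<phi> (N (Suc j)) t e"
      using coherent_imp_line_translation[OF normal_imp_subgroup[OF nor(1)] Suc.prems(2-4)] by blast
    show ?case
    \<comment> \<open>A least positive element lets coherence pass to the next larger term; without
      one the translation numbers are dense and already yield the measure.\<close>
    proof (cases "\<exists>e'\<in>N (Suc j). lt \<one>\<^bsub>G\<^esub> e' \<and> (\<forall>h\<in>N (Suc j). lt \<one>\<^bsub>G\<^esub> h \<longrightarrow> \<not> lt h e')")
      case True
      then obtain e' where e': "e' \<in> N (Suc j)" "lt \<one>\<^bsub>G\<^esub> e'"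
        "\<And>h. h \<in> N (Suc j) \<Longrightarrow> lt \<one>\<^bsub>G\<^esub> h \<Longrightarrow> \<not> lt h e'" by blast
      have sub: "N (Suc j) \<subseteq> N j" using Suc.prems by (intro N(4)) simp
      have "coherent (N j)"
        by (rule coherent_extension[OF nor(1) normal_imp_subgroup[OF nor(2)] sub Suc.prems(2)
              coincident[OF Suc_leD[OF Suc.prems(1)]] e'])
      then show ?thesis
        using Suc.prems e' sub by (intro Suc.IH[of e']) auto
    next
      case False
      interpret L: line_translation G \<phi> "N (Suc j)" t e by (rule t)
      have "\<exists>h\<in>N (Suc j). a < t h \<and> t h < b" if "a < b" for a b
        using False that by (intro L.least_positive_or_dense) blast+
      then show ?thesis
        using quasi_preserved_measure_if_dense_or_full[OF nor(1) t] by blast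
    qed
  qed
  then show ?thesis using base m(2) k by blast
qed

end
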